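(* Let $N\ge2$, let $\Sigma\subset\mathbb{C}^N$ be compact, and let $k$ be an integer with $2\le k\le N$. If $K\subset\widehat{\Sigma}^{\,k}$ is a compact polynomially convex set, and if the set of (restrictions to $\Sigma$ of) polynomials that have no zeros on $K$ is dense in $P(\Sigma)$, then there is a compact subset $X$ of $\Sigma$ such that $h_r^{k-1}(X)\supset K$ and $P(X)$ has dense invertibles.
   Context: Let $X\subset\mathbb{C}^N$ be compact. An analytic subvariety of $\mathbb{C}^N$ of pure codimension $m$ means a pure-dimensional analytic subvariety of $\mathbb{C}^N$ of dimension $N-m$. The polynomial hull is $\widehat{X}=\{z: |p(z)|\le\max_X|p| \text{ for all polynomials } p\}$; $X$ is polynomially convex if $\widehat X=X$. For $1\le k\le N$, the $k$-rational hull $h_r^k(X)$ is the set of $z\in\mathbb{C}^N$ such that every analytic subvariety of $\mathbb{C}^N$ of pure codimension $\le k$ that passes through $z$ intersects $X$. For $2\le k\le N$ the $k$-polynomial hull $\widehat{X}^{\,k}$ is the set of $z\in\mathbb{C}^N$ such that $z\in h_r^{k-1}(X)$ and $z\in\widehat{X\cap V}$ for every analytic subvariety $V$ of $\mathbb{C}^N$ of pure codimension $\le k-1$ passing through $z$. $P(X)$ is the uniform closure on $X$ of the polynomials in the coordinate functions. A uniform algebra has dense invertibles if its invertible elements are dense in it. *)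

theory Defs
  imports "HOL-Analysis.Analysis"
begin

inductive_set poly_fun :: "(complex^'n \<Rightarrow> complex) set" where
  const: "(\<lambda>z. c) \<in> poly_fun"
| coord: "(\<lambda>z. z $ i) \<in> poly_fun"
| add: "p \<in> poly_fun \<Longrightarrow> q \<in> poly_fun \<Longrightarrow> (\<lambda>z. p z + q z) \<in> poly_fun"
| mult: "p \<in> poly_fun \<Longrightarrow> q \<in> poly_fun \<Longrightarrow> (\<lambda>z. p z * q z) \<in> poly_fun"

text \<open>Polynomial hull (for compact X, max over X; empty X has empty hull).\<close>
definition poly_hull :: "(complex^'n) set \<Rightarrow> (complex^'n) set" where
  "poly_hull X = {z. \<forall>p\<in>poly_fun. \<exists>x\<in>X. cmod (p z) \<le> cmod (p x)}"

definition holo_on :: "(complex^'n) set \<Rightarrow> (complex^'n \<Rightarrow> complex) \<Rightarrow> bool" where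
  "holo_on U f \<longleftrightarrow> (\<forall>x\<in>U. \<exists>f'. (f has_derivative f') (at x) \<and>
       (\<forall>(c::complex) v. f' (c *s v) = c * f' v))"

definition analytic_subvariety :: "(complex^'n) set \<Rightarrow> bool" where
  "analytic_subvariety V \<longleftrightarrow> closed V \<and>
     (\<forall>p. \<exists>U m g. open U \<and> p \<in> U \<and> (\<forall>j<m. holo_on U (g j)) \<and>
          V \<inter> U = {x\<in>U. \<forall>j<(m::nat). g j x = 0})"

text \<open>p is a regular point of V of dimension d: near p, V is a complex submanifold of
  dimension d, i.e. the common zero set of N - d holomorphic functions whose
  differentials are linearly independent over C at each point.\<close>
definition regular_point_dim :: "(complex^'n) set \<Rightarrow> complex^'n \<Rightarrow> nat \<Rightarrow> bool" where
  "regular_point_dim V p d \<longleftrightarrow> p \<in> V \<and> d \<le> CARD('n) \<and>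
     (\<exists>U f. open U \<and> p \<in> U \<and> (\<forall>i<CARD('n) - d. holo_on U (f i)) \<and>
        V \<inter> U = {x\<in>U. \<forall>i<CARD('n) - d. f i x = 0} \<and>
        (\<forall>x\<in>V \<inter> U. \<forall>c::nat \<Rightarrow> complex.
            (\<forall>v. (\<Sum>i<CARD('n) - d. c i * frechet_derivative (f i) (at x) v) = 0)
            \<longrightarrow> (\<forall>i<CARD('n) - d. c i = 0)))"

definition regular_point :: "(complex^'n) set \<Rightarrow> complex^'n \<Rightarrow> bool" where
  "regular_point V p \<longleftrightarrow> (\<exists>d. regular_point_dim V p d)"

definition pure_dim_subvariety :: "nat \<Rightarrow> (complex^'n) set \<Rightarrow> bool" where
  "pure_dim_subvariety d V \<longleftrightarrow> analytic_subvariety V \<and>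
     V \<subseteq> closure {p. regular_point V p} \<and>
     (\<forall>p. regular_point V p \<longrightarrow> regular_point_dim V p d)"

definition pure_codim_subvariety :: "nat \<Rightarrow> (complex^'n) set \<Rightarrow> bool" where
  "pure_codim_subvariety m V \<longleftrightarrow> m \<le> CARD('n) \<and> pure_dim_subvariety (CARD('n) - m) V"

definition rat_hull_k :: "nat \<Rightarrow> (complex^'n) set \<Rightarrow> (complex^'n) set" where
  "rat_hull_k k X = {z. \<forall>V m. 1 \<le> m \<and> m \<le> k \<and> pure_codim_subvariety m V \<and> z \<in> V
                        \<longrightarrow> V \<inter> X \<noteq> {}}"

text \<open>k-polynomial hull (for 2 \<le> k \<le> N).\<close>
definition poly_hull_k :: "nat \<Rightarrow> (complex^'n) set \<Rightarrow> (complex^'n) set" where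
  "poly_hull_k k X = {z. z \<in> rat_hull_k (k - 1) X \<and>
      (\<forall>V m. 1 \<le> m \<and> m \<le> k - 1 \<and> pure_codim_subvariety m V \<and> z \<in> V
          \<longrightarrow> z \<in> poly_hull (X \<inter> V))}"

text \<open>P(X): uniform closure on X of the polynomials (functions compared on X only).\<close>
definition PX :: "(complex^'n) set \<Rightarrow> (complex^'n \<Rightarrow> complex) set" where
  "PX X = {f. \<forall>e>0. \<exists>p\<in>poly_fun. \<forall>x\<in>X. cmod (f x - p x) < e}"

definition invertible_PX :: "(complex^'n) set \<Rightarrow> (complex^'n \<Rightarrow> complex) \<Rightarrow> bool" where
  "invertible_PX X f \<longleftrightarrow> f \<in> PX X \<and> (\<exists>g\<in>PX X. \<forall>x\<in>X. f x * g x = 1)"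

definition dense_invertibles_PX :: "(complex^'n) set \<Rightarrow> bool" where
  "dense_invertibles_PX X \<longleftrightarrow>
     (\<forall>f\<in>PX X. \<forall>e>0. \<exists>g. invertible_PX X g \<and> (\<forall>x\<in>X. cmod (f x - g x) < e))"

end

theory Submission
  imports Defs "HOL-Library.Function_Algebras"
begin

text \<open>Choose polynomials \<open>p n\<close> without zeros on \<open>K\<close> that are dense in \<open>P(\<Sigma>)\<close>. As \<open>K\<close> is polynomially
  convex, each \<open>p n\<close> is invertible in \<open>P(K)\<close>, so it has polynomial multiples \<open>h\<close> arbitrarily close to 1
  on \<open>K\<close>. Multiplying by a polynomial close to 1 on \<open>K\<close> and close to 0 where the previous multiple has
  real part below \<open>1 / 2\<close>, one arranges that the sets \<open>Y n = {x \<in> \<Sigma>. 1 / 2 \<le> Re (h n x)}\<close>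
  decrease. On \<open>X = (\<Inter>n. Y n)\<close> a multiple of each \<open>p n\<close> stays in a half plane away from 0, so
  \<open>p n\<close> is invertible in \<open>P(X)\<close>. If \<open>V\<close> passes through \<open>z \<in> K\<close>, then \<open>z\<close> lies in the polynomial hull
  of \<open>\<Sigma> \<inter> V\<close>, and since \<open>1 / 2 < Re (h n z)\<close>, \<open>V\<close> meets every \<open>Y n\<close>, hence \<open>X\<close> by compactness.\<close>

section \<open>Spectra in complex seminormed algebras\<close>

text \<open>Modelled on P(K) modulo an ideal. Elements are represented by functions, and the
  quotient is encoded by the seminorm: equality there means a difference in \<open>null\<close>.
  Inverses will be supplied by an argument by contradiction, so limits are never formed in
  \<open>A\<close>.\<close>

locale complex_seminormed_algebra =
  fixes A :: "'a::comm_ring_1 set" and scal :: "complex \<Rightarrow> 'a" and N :: "'a \<Rightarrow> real"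
  assumes scal_add: "scal (a + b) = scal a + scal b"
    and scal_mult: "scal (a * b) = scal a * scal b"
    and scal_1: "scal 1 = 1"
    and scal_in [simp, intro]: "scal a \<in> A"
    and add_in [simp, intro]: "f \<in> A \<Longrightarrow> g \<in> A \<Longrightarrow> f + g \<in> A"
    and mult_in [simp, intro]: "f \<in> A \<Longrightarrow> g \<in> A \<Longrightarrow> f * g \<in> A"
    and N_nonneg [simp]: "f \<in> A \<Longrightarrow> 0 \<le> N f"
    and N_add: "f \<in> A \<Longrightarrow> g \<in> A \<Longrightarrow> N (f + g) \<le> N f + N g"
    and N_mult: "f \<in> A \<Longrightarrow> g \<in> A \<Longrightarrow> N (f * g) \<le> N f * N g"
    and N_scal: "N (scal a) \<le> cmod a"
    and N_one: "1 \<le> N 1"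
begin

lemma scal_0: "scal 0 = 0"
  using scal_add[of 0 0] by simp

lemma scal_minus: "scal (- a) = - scal a"
  using scal_add[of a "- a"] by (simp add: scal_0 eq_neg_iff_add_eq_0 add.commute)

lemma scal_diff: "scal (a - b) = scal a - scal b"
  using scal_add[of a "- b"] by (simp add: scal_minus)

lemma scal_power: "scal (a ^ n) = scal a ^ n"
  by (induction n) (simp_all add: scal_1 scal_mult)

lemma scal_sum: "scal (sum F S) = (\<Sum>k\<in>S. scal (F k))"
  by (induction S rule: infinite_finite_induct) (simp_all add: scal_0 scal_add)

lemma one_in [simp, intro]: "1 \<in> A"
  using scal_in[of 1] by (simp add: scal_1)

lemma zero_in [simp, intro]: "0 \<in> A"
  using scal_in[of 0] by (simp add: scal_0)

lemma minus_in [simp, intro]: "f \<in> A \<Longrightarrow> - f \<in> A"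
  using mult_in[OF scal_in[of "- 1"], of f] by (simp add: scal_minus scal_1)

lemma diff_in [simp, intro]: "f \<in> A \<Longrightarrow> g \<in> A \<Longrightarrow> f - g \<in> A"
  using add_in[of f "- g"] by simp

lemma power_in [simp, intro]: "f \<in> A \<Longrightarrow> f ^ n \<in> A"
  by (induction n) auto

lemma sum_in [intro]: "(\<And>k. k \<in> S \<Longrightarrow> F k \<in> A) \<Longrightarrow> sum F S \<in> A"
  by (induction S rule: infinite_finite_induct) auto

lemma N_one_eq: "N 1 = 1"
  using N_one N_scal[of 1] by (simp add: scal_1)

lemma N_0: "N 0 = 0"
  using N_scal[of 0] by (simp add: scal_0 order.antisym)

lemma N_scal_mult: "f \<in> A \<Longrightarrow> N (scal a * f) \<le> cmod a * N f"
  by (meson N_mult N_nonneg N_scal mult_right_mono order_trans scal_in)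

lemma N_minus: "f \<in> A \<Longrightarrow> N (- f) = N f"
proof -
  have le: "N (- g) \<le> N g" if "g \<in> A" for g
    using N_scal_mult[OF that, of "- 1"] by (simp add: scal_minus scal_1)
  assume "f \<in> A"
  with le[of f] le[of "- f"] show ?thesis by simp
qed

lemma N_diff: "f \<in> A \<Longrightarrow> g \<in> A \<Longrightarrow> N (f - g) \<le> N f + N g"
  using N_add[of f "- g"] by (simp add: N_minus)

lemma N_sum: "(\<And>k. k \<in> S \<Longrightarrow> F k \<in> A) \<Longrightarrow> N (sum F S) \<le> (\<Sum>k\<in>S. N (F k))"
proof (induction S rule: infinite_finite_induct)
  case (insert k S)
  have "N (F k + sum F S) \<le> N (F k) + N (sum F S)"
    by (intro N_add sum_in insert.prems) auto
  with insert show ?case by force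
qed (simp_all add: N_0)

lemma N_power: "f \<in> A \<Longrightarrow> N (f ^ n) \<le> N f ^ n"
proof (induction n)
  case (Suc n)
  have "N (f ^ Suc n) \<le> N f * N (f ^ n)" using Suc.prems by (simp add: N_mult)
  also have "\<dots> \<le> N f * N f ^ n" using Suc by (intro mult_left_mono) auto
  finally show ?case by simp
qed (simp add: N_one_eq)

definition null :: "'a set" where "null = {f \<in> A. N f = 0}"

lemma null_add: "f \<in> null \<Longrightarrow> g \<in> null \<Longrightarrow> f + g \<in> null"
  using N_add[of f g] by (auto simp: null_def order.antisym)

lemma null_mult: "f \<in> A \<Longrightarrow> g \<in> null \<Longrightarrow> f * g \<in> null"
  using N_mult[of f g] by (auto simp: null_def order.antisym)

lemma null_minus: "f \<in> null \<Longrightarrow> - f \<in> null"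
  by (auto simp: null_def N_minus)

lemma null_diff: "f \<in> null \<Longrightarrow> g \<in> null \<Longrightarrow> f - g \<in> null"
  using null_add[of f "- g"] null_minus by auto

lemma null_sum: "(\<And>k. k \<in> S \<Longrightarrow> F k \<in> null) \<Longrightarrow> sum F S \<in> null"
proof (induction S rule: infinite_finite_induct)
  case (insert k S)
  then show ?case by (simp add: null_add)
qed (simp_all add: null_def N_0)

lemma N_cong: "f \<in> A \<Longrightarrow> g \<in> A \<Longrightarrow> f - g \<in> null \<Longrightarrow> N f = N g"
  using N_add[of "f - g" g] N_diff[of f "f - g"] by (auto simp: null_def)

lemma N_le_add_diff: "f \<in> A \<Longrightarrow> g \<in> A \<Longrightarrow> N f \<le> N g + N (f - g)"
  using N_add[of g "f - g"] by simp

end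

section \<open>Resolvents and averages over roots of unity\<close>

lemma sum_powers_root_of_unity:
  fixes n m :: nat
  assumes "0 < m" "m < n"
  defines "w \<equiv> cis (2 * pi / real n)"
  shows "(\<Sum>k<n. (w ^ k) ^ m) = 0"
proof -
  have w: "w ^ j = exp (2 * of_real pi * \<i> * of_nat j / of_nat n)" for j
    unfolding w_def cis_conv_exp exp_of_nat_mult[symmetric] by (simp add: mult_ac)
  \<comment> \<open>As 0 < m < n, n does not divide m. So \<open>w ^ m\<close> is an n-th root of
    unity other than 1, and its geometric sum vanishes.\<close>
  have "w ^ m \<noteq> 1"
    unfolding w using assms(1,2) complex_root_unity_eq_1[of n m] by (auto dest: dvd_imp_le)
  moreover have "(w ^ m) ^ n = 1"
  proof -
    have "w ^ n = 1" using assms by (simp add: w_def Complex.DeMoivre)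
    then show ?thesis by (simp add: power_mult[symmetric] mult.commute[of m n] power_mult)
  qed
  moreover have "(w ^ k) ^ m = (w ^ m) ^ k" for k
    by (simp add: power_mult[symmetric] mult.commute)
  ultimately show ?thesis by (simp add: geometric_sum)
qed

text \<open>An element with empty spectrum; the locale turns out to be inconsistent.\<close>

locale resolvent_everywhere = complex_seminormed_algebra A scal N
  for A :: "'a::comm_ring_1 set" and scal N +
  fixes x :: 'a and G :: "complex \<Rightarrow> 'a"
  assumes x_in [simp, intro]: "x \<in> A" and G_in [simp, intro]: "G l \<in> A"
    and G_null: "1 - (x - scal l) * G l \<in> null"
begin

text \<open>Multiply the defect of each resolvent by the other resolvent and subtract: the terms
  with x cancel by commutativity.\<close>

lemma resolvent_identity: "G l - G m - scal (l - m) * (G l * G m) \<in> null"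
proof -
  have "G l * (1 - (x - scal m) * G m) - G m * (1 - (x - scal l) * G l) \<in> null"
    by (intro null_diff null_mult G_null G_in)
  also have "G l * (1 - (x - scal m) * G m) - G m * (1 - (x - scal l) * G l)
      = G l - G m - scal (l - m) * (G l * G m)"
    by (simp add: scal_diff algebra_simps)
  finally show ?thesis .
qed

lemma N_G_diff: "N (G l - G m) \<le> cmod (l - m) * (N (G l) * N (G m))"
proof -
  have "N (G l - G m) = N (scal (l - m) * (G l * G m))"
    by (intro N_cong resolvent_identity) auto
  also have "\<dots> \<le> cmod (l - m) * N (G l * G m)" by (intro N_scal_mult) auto
  also have "\<dots> \<le> cmod (l - m) * (N (G l) * N (G m))" by (intro mult_left_mono N_mult) auto
  finally show ?thesis .
qed

text \<open>The estimate \<open>N_G_diff\<close> bounds the difference by half of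
  \<open>N (G m)\<close>, which is absorbed on the left. This local bound turns
  \<open>N_G_diff\<close> into a continuity estimate.\<close>

lemma N_G_doubling:
  assumes "cmod (m - l) * N (G l) \<le> 1 / 2"
  shows "N (G m) \<le> 2 * N (G l)"
proof -
  have "N (G m - G l) \<le> (cmod (m - l) * N (G l)) * N (G m)"
    using N_G_diff[of m l] by (simp add: mult_ac)
  also have "\<dots> \<le> 1 / 2 * N (G m)" using assms by (intro mult_right_mono) auto
  finally show ?thesis using N_le_add_diff[of "G m" "G l"] by auto
qed

text \<open>By \<open>N_G_doubling\<close> the right side of \<open>N_G_diff\<close> is a constant
  times the distance near any point, so the seminorm of the resolvent is continuous, hence bounded
  on compact sets.\<close>

lemma N_G_bounded:
  assumes "compact S"
  obtains D where "D > 0" "\<And>l. l \<in> S \<Longrightarrow> N (G l) \<le> D"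
proof -
  have "continuous_on S (\<lambda>l. N (G l))"
  proof (rule continuous_on_eq_continuous_within[THEN iffD2], rule ballI)
    fix l
    let ?c = "N (G l)"
    have "((\<lambda>m. N (G m) - ?c) \<longlongrightarrow> 0) (at l)"
    proof (rule Lim_null_comparison)
      have "((\<lambda>m. cmod (m - l) * ?c) \<longlongrightarrow> cmod (l - l) * ?c) (at l)"
        by (intro tendsto_intros)
      then have "\<forall>\<^sub>F m in at l. cmod (m - l) * ?c < 1 / 2"
        by (rule order_tendstoD) simp
      then show "\<forall>\<^sub>F m in at l. norm (N (G m) - ?c) \<le> cmod (m - l) * (2 * ?c * ?c)"
      proof eventually_elim
        case (elim m)
        have "norm (N (G m) - ?c) \<le> N (G m - G l)"
          using N_le_add_diff[of "G m" "G l"] N_le_add_diff[of "G l" "G m"] N_minus[of "G m - G l"]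
          by auto
        also have "\<dots> \<le> cmod (m - l) * (N (G m) * ?c)" by (rule N_G_diff)
        also have "\<dots> \<le> cmod (m - l) * (2 * ?c * ?c)"
          using N_G_doubling[of m l] elim by (intro mult_left_mono mult_right_mono) auto
        finally show ?case .
      qed
      have "((\<lambda>m. cmod (m - l) * (2 * ?c * ?c)) \<longlongrightarrow> cmod (l - l) * (2 * ?c * ?c)) (at l)"
        by (intro tendsto_intros)
      then show "((\<lambda>m. cmod (m - l) * (2 * ?c * ?c)) \<longlongrightarrow> 0) (at l)" by simp
    qed
    then have "((\<lambda>m. N (G m)) \<longlongrightarrow> ?c) (at l)" by (simp add: LIM_zero_iff)
    then show "continuous (at l within S) (\<lambda>l. N (G l))"
      unfolding continuous_within by (rule tendsto_within_subset) simp
  qed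
  then have "bounded ((\<lambda>l. N (G l)) ` S)"
    using assms compact_continuous_image compact_imp_bounded by blast
  then obtain D where "D > 0" "\<And>l. l \<in> S \<Longrightarrow> norm (N (G l)) \<le> D"
    unfolding bounded_pos by auto
  then show ?thesis using that by force
qed

text \<open>Averaging \<open>w / (w - x)\<close> over the \<open>n\<close> roots of \<open>w ^ n = r ^ n\<close> gives
  \<open>r ^ n / (r ^ n - x ^ n)\<close>.\<close>

definition avg :: "nat \<Rightarrow> real \<Rightarrow> 'a" where
  "avg n r = scal (1 / of_nat n) *
     (\<Sum>k<n. scal (- (of_real r * cis (2 * pi / real n) ^ k)) * G (of_real r * cis (2 * pi / real n) ^ k))"

lemma avg_in [simp, intro]: "avg n r \<in> A"
  unfolding avg_def by (intro mult_in sum_in) auto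

text \<open>For each root w, dividing \<open>w ^ n - x ^ n\<close> by w - x leaves the sum of
  \<open>w ^ (n - Suc i) * x ^ i\<close>. After multiplication by w and summation over the roots,
  the power sums with 0 < i < n vanish and only the constant term n times \<open>r ^ n\<close>
  remains.\<close>

lemma avg_identity:
  assumes "n > 0"
  shows "avg n r * (scal (of_real r ^ n) - x ^ n) - scal (of_real r ^ n) \<in> null"
proof -
  let ?w = "\<lambda>k. of_real r * cis (2 * pi / real n) ^ k"
  let ?S = "\<lambda>k. \<Sum>i<n. scal (?w k) ^ (n - Suc i) * x ^ i"
  have wn: "?w k ^ n = of_real r ^ n" for k
  proof -
    have "(cis (2 * pi / real n) ^ k) ^ n = (cis (2 * pi / real n) ^ n) ^ k"
      by (simp only: power_mult[symmetric] mult.commute)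
    also have "cis (2 * pi / real n) ^ n = 1" using assms by (simp add: Complex.DeMoivre)
    finally show ?thesis by (simp add: power_mult_distrib)
  qed
  have eq: "scal (?w k) * (?S k) - scal (- ?w k) * G (?w k) * (scal (of_real r ^ n) - x ^ n)
      = (scal (?w k) * ?S k) * (1 - (x - scal (?w k)) * G (?w k))" for k
  proof -
    have d: "x ^ n - scal (of_real r ^ n) = (x - scal (?w k)) * ?S k"
      by (subst wn[of k, symmetric]) (simp only: scal_power power_diff_sumr2)
    have "scal (- ?w k) * G (?w k) * (scal (of_real r ^ n) - x ^ n)
      = scal (?w k) * G (?w k) * (x ^ n - scal (of_real r ^ n))"
      by (simp only: scal_minus) (simp add: algebra_simps)
    then show ?thesis unfolding d by (simp add: algebra_simps)
  qed
  have S: "(\<Sum>k<n. scal (?w k) * ?S k) = scal (of_nat n) * scal (of_real r ^ n)"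
  proof -
    have "(\<Sum>k<n. scal (?w k) * ?S k) = (\<Sum>k<n. \<Sum>i<n. scal (?w k ^ (n - i)) * x ^ i)"
    proof (intro sum.cong refl)
      fix k
      show "scal (?w k) * ?S k = (\<Sum>i<n. scal (?w k ^ (n - i)) * x ^ i)"
        unfolding sum_distrib_left
      proof (intro sum.cong refl)
        fix i assume "i \<in> {..<n}"
        then have "n - i = Suc (n - Suc i)" by auto
        then show "scal (?w k) * (scal (?w k) ^ (n - Suc i) * x ^ i) = scal (?w k ^ (n - i)) * x ^ i"
          by (simp only: scal_power[symmetric] scal_mult[symmetric] power_Suc mult.assoc[symmetric])
      qed
    qed
    also have "\<dots> = (\<Sum>i<n. scal (\<Sum>k<n. ?w k ^ (n - i)) * x ^ i)"
      by (subst sum.swap) (simp only: scal_sum sum_distrib_right)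
    also have "\<dots> = (\<Sum>i<n. if i = 0 then scal (of_nat n * of_real r ^ n) else 0)"
    proof (intro sum.cong refl)
      fix i assume i: "i \<in> {..<n}"
      show "scal (\<Sum>k<n. ?w k ^ (n - i)) * x ^ i = (if i = 0 then scal (of_nat n * of_real r ^ n) else 0)"
      proof (cases "i = 0")
        case True
        then show ?thesis by (simp only: wn diff_zero if_True power_0 mult_1_right) simp
      next
        case False
        then have "(\<Sum>k<n. ?w k ^ (n - i)) = 0"
          using sum_powers_root_of_unity[of "n - i" n] i
          by (simp add: power_mult_distrib sum_distrib_left[symmetric])
        with False show ?thesis by (simp add: scal_0)
      qed
    qed
    also have "\<dots> = scal (of_nat n) * scal (of_real r ^ n)"
      using assms by (simp add: scal_mult)
    finally show ?thesis .
  qed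
  have "(\<Sum>k<n. scal (?w k) * ?S k - scal (- ?w k) * G (?w k) * (scal (of_real r ^ n) - x ^ n)) \<in> null"
    unfolding eq by (intro null_sum null_mult G_null mult_in sum_in) auto
  then have "scal (1 / of_nat n) * (\<Sum>k<n. scal (?w k) * ?S k - scal (- ?w k) * G (?w k) * (scal (of_real r ^ n) - x ^ n)) \<in> null"
    by (intro null_mult) auto
  also have "scal (1 / of_nat n) * (\<Sum>k<n. scal (?w k) * ?S k - scal (- ?w k) * G (?w k) * (scal (of_real r ^ n) - x ^ n))
     = scal (1 / of_nat n) * (scal (of_nat n) * scal (of_real r ^ n)) - avg n r * (scal (of_real r ^ n) - x ^ n)"
    unfolding sum_subtractf S avg_def
    by (simp only: right_diff_distrib[of "scal (1 / of_nat n)"] sum_distrib_right mult.assoc)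
  also have "scal (1 / of_nat n) * (scal (of_nat n) * scal (of_real r ^ n)) = scal (of_real r ^ n)"
    using assms by (simp add: scal_mult[symmetric])
  finally show ?thesis using null_minus by fastforce
qed

lemma N_avg:
  assumes "n > 0" "0 \<le> r" "\<And>l. cmod l = r \<Longrightarrow> N (G l) \<le> D"
  shows "N (avg n r) \<le> r * D"
proof -
  let ?w = "\<lambda>k. of_real r * cis (2 * pi / real n) ^ k"
  have w: "cmod (?w k) = r" for k using assms by (simp add: norm_mult norm_power)
  have "N (avg n r) \<le> cmod (1 / of_nat n) * N (\<Sum>k<n. scal (- ?w k) * G (?w k))"
    unfolding avg_def by (intro N_scal_mult sum_in) auto
  also have "\<dots> \<le> cmod (1 / of_nat n) * (\<Sum>k<n. N (scal (- ?w k) * G (?w k)))"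
    by (intro mult_left_mono N_sum) auto
  also have "\<dots> \<le> cmod (1 / of_nat n) * (\<Sum>k<n. r * D)"
  proof (intro mult_left_mono sum_mono)
    fix k
    have "N (scal (- ?w k) * G (?w k)) \<le> cmod (- ?w k) * N (G (?w k))" by (intro N_scal_mult) auto
    also have "\<dots> \<le> r * D"
      using assms w[of k] by (simp only: norm_minus_cancel) (intro mult_left_mono assms(3), auto)
    finally show "N (scal (- ?w k) * G (?w k)) \<le> r * D" .
  qed auto
  also have "\<dots> = r * D" using assms by (simp add: norm_divide)
  finally show ?thesis .
qed

text \<open>The Lipschitz constant does not depend on n, so one choice of radii serves all large n
  at once. In each summand the factor w and the resolvent are varied separately.\<close>

lemma N_avg_diff:
  assumes "n > 0" "0 \<le> r" "r \<le> R" "0 \<le> s" "s \<le> R"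
    and D: "\<And>l. cmod l \<le> R \<Longrightarrow> N (G l) \<le> D"
  shows "N (avg n r - avg n s) \<le> \<bar>r - s\<bar> * (D + R * (D * D))"
proof -
  define w where "w = (\<lambda>t k. of_real t * cis (2 * pi / real n) ^ k)"
  have w: "cmod (w t k) = \<bar>t\<bar>" for t k by (simp add: norm_mult norm_power w_def)
  have wd: "cmod (w r k - w s k) = \<bar>r - s\<bar>" for k
  proof -
    have "w r k - w s k = w (r - s) k" by (simp add: w_def algebra_simps)
    then show ?thesis by (simp add: w)
  qed
  have "N (G 0) \<le> D" using assms by (intro D) auto
  then have D0: "0 \<le> D" by (rule order_trans[OF N_nonneg[OF G_in]])
  have term_le: "N (scal (- w r k) * G (w r k) - scal (- w s k) * G (w s k)) \<le> \<bar>r - s\<bar> * (D + R * (D * D))" for k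
  proof -
    have G: "N (G (w r k)) \<le> D" "N (G (w s k)) \<le> D" using assms by (auto intro!: D simp: w)
    have "scal (- w r k) * G (w r k) - scal (- w s k) * G (w s k)
      = scal (- (w r k - w s k)) * G (w r k) + scal (- w s k) * (G (w r k) - G (w s k))"
      by (simp add: scal_minus scal_diff algebra_simps)
    also have "N \<dots> \<le> N (scal (- (w r k - w s k)) * G (w r k)) + N (scal (- w s k) * (G (w r k) - G (w s k)))"
      by (intro N_add) auto
    also have "\<dots> \<le> cmod (- (w r k - w s k)) * N (G (w r k)) + cmod (- w s k) * N (G (w r k) - G (w s k))"
      by (intro add_mono N_scal_mult) auto
    also have "\<dots> \<le> \<bar>r - s\<bar> * D + R * (\<bar>r - s\<bar> * (D * D))"
    proof (intro add_mono mult_mono)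
      have "N (G (w r k) - G (w s k)) \<le> cmod (w r k - w s k) * (N (G (w r k)) * N (G (w s k)))"
        by (rule N_G_diff)
      also have "\<dots> \<le> \<bar>r - s\<bar> * (D * D)"
        using G D0 by (intro mult_mono) (auto simp: wd)
      finally show "N (G (w r k) - G (w s k)) \<le> \<bar>r - s\<bar> * (D * D)" .
      show "cmod (- (w r k - w s k)) \<le> \<bar>r - s\<bar>" by (simp only: norm_minus_cancel wd)
      show "cmod (- w s k) \<le> R" using assms by (simp add: w)
    qed (use G D0 assms in auto)
    finally show ?thesis by (simp add: algebra_simps)
  qed
  have "avg n r - avg n s = scal (1 / of_nat n) * (\<Sum>k<n. scal (- w r k) * G (w r k) - scal (- w s k) * G (w s k))"
    by (simp add: avg_def w_def sum_subtractf right_diff_distrib)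
  also have "N \<dots> \<le> cmod (1 / of_nat n) * N (\<Sum>k<n. scal (- w r k) * G (w r k) - scal (- w s k) * G (w s k))"
    by (intro N_scal_mult sum_in) auto
  also have "\<dots> \<le> cmod (1 / of_nat n) * (\<Sum>k<n. \<bar>r - s\<bar> * (D + R * (D * D)))"
    by (intro mult_left_mono order_trans[OF N_sum] sum_mono term_le) auto
  also have "\<dots> = \<bar>r - s\<bar> * (D + R * (D * D))" using assms by (simp add: norm_divide)
  finally show ?thesis .
qed

section \<open>The spectral radius\<close>

definition growth_rates :: "real set" where
  "growth_rates = {r. 0 < r \<and> (\<exists>C. \<forall>\<^sub>F n in sequentially. N (x ^ n) \<le> C * r ^ n)}"

text \<open>The infimum of \<open>growth_rates\<close> is the spectral radius of x; the bound makes
  it positive. Since \<open>G 0\<close> inverts x modulo \<open>null\<close>, 1 is at most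
  \<open>N (x ^ n) * N (G 0) ^ n\<close>, and this would tend to 0 if r were too small.\<close>

lemma growth_rates_lower_bound:
  assumes "r \<in> growth_rates"
  shows "1 \<le> r * (N (G 0) + 1)"
proof (rule ccontr)
  let ?c = "N (G 0) + 1"
  assume less: "\<not> ?thesis"
  obtain C where r: "0 < r" and C: "\<forall>\<^sub>F n in sequentially. N (x ^ n) \<le> C * r ^ n"
    using assms by (auto simp: growth_rates_def)
  have xG: "N (x * G 0 - 1) = 0"
    using null_minus[OF G_null[of 0]] by (simp add: scal_0 null_def)
  have pow: "(x * G 0) ^ n - 1 \<in> null" for n
  proof (induction n)
    case (Suc n)
    have "(x * G 0) ^ n * (x * G 0 - 1) + ((x * G 0) ^ n - 1) \<in> null"
      by (intro null_add null_mult Suc) (use xG in \<open>auto simp: null_def\<close>)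
    then show ?case by (simp add: algebra_simps)
  qed (simp add: null_def N_0)
  have "(\<lambda>n. C * (r * ?c) ^ n) \<longlonglongrightarrow> C * 0"
    using less r by (intro tendsto_intros LIMSEQ_realpow_zero) auto
  then have "\<forall>\<^sub>F n in sequentially. C * (r * ?c) ^ n < 1"
    by (rule order_tendstoD) simp
  with C have "\<forall>\<^sub>F n in sequentially. False"
  proof eventually_elim
    case (elim n)
    have "1 = N ((x * G 0) ^ n)"
      using N_cong[OF _ _ pow[of n]] by (simp add: N_one_eq)
    also have "\<dots> \<le> N (x ^ n) * N (G 0 ^ n)" unfolding power_mult_distrib by (intro N_mult) auto
    also have "\<dots> \<le> (C * r ^ n) * ?c ^ n"
      using elim order_trans[OF N_nonneg[of "x ^ n"]]
      by (intro mult_mono order_trans[OF N_power[of "G 0"]] power_mono) auto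
    also have "\<dots> = C * (r * ?c) ^ n" by (simp add: power_mult_distrib)
    finally show False using elim by simp
  qed
  then show False by simp
qed

text \<open>Rickart's argument: slightly outside the spectral radius the averages tend to 1; as they are
  equicontinuous in the radius, they stay close to 1 slightly inside it, which makes the powers of
  \<open>x\<close> grow more slowly than the spectral radius allows.\<close>

lemma contradiction: False
proof -
  define rho where "rho = Inf growth_rates"
  have bdd: "bdd_below growth_rates" by (intro bdd_belowI[of _ 0]) (auto simp: growth_rates_def)
  have "N x + 1 \<in> growth_rates"
  proof -
    have "N (x ^ n) \<le> 1 * (N x + 1) ^ n" for n
      using order_trans[OF N_power[of x n] power_mono[of "N x" "N x + 1" n]] by simp
    then have "\<forall>\<^sub>F n in sequentially. N (x ^ n) \<le> 1 * (N x + 1) ^ n" by simp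
    then show ?thesis unfolding growth_rates_def by (auto intro!: exI[of _ "1::real"] add_nonneg_pos)
  qed
  then have ne: "growth_rates \<noteq> {}" by auto
  have c: "N (G 0) + 1 > 0" by (intro add_nonneg_pos) auto
  have "1 / (N (G 0) + 1) \<le> rho"
    unfolding rho_def using growth_rates_lower_bound c
    by (intro cInf_greatest[OF ne]) (auto simp: field_simps)
  then have rho: "rho > 0" using c by (auto intro: less_le_trans[of _ "1 / (N (G 0) + 1)"])
  define R where "R = rho + 1"
  obtain D where D: "D > 0" "\<And>l. cmod l \<le> R \<Longrightarrow> N (G l) \<le> D"
    using N_G_bounded[of "cball 0 R"] by (auto simp: dist_norm)
  define L where "L = D + R * (D * D)"
  have L: "L > 0" using D rho by (auto simp: L_def R_def intro!: add_pos_pos mult_pos_pos)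
  \<comment> \<open>The bound rho / 2 keeps s positive, 1 / 2 keeps r below R, and 1 / (8 L) makes
    the averages at r and s, whose radii differ by 2 d, differ by at most 1 / 4.\<close>
  define d where "d = min (1 / 2) (min (rho / 2) (1 / (8 * L)))"
  have d: "0 < d" "d \<le> 1 / 2" "d \<le> rho / 2" "2 * d * L \<le> 1 / 4"
  proof -
    have "d * L \<le> 1 / (8 * L) * L" using L by (intro mult_right_mono) (auto simp: d_def)
    then show "2 * d * L \<le> 1 / 4" using L by simp
  qed (use rho L in \<open>auto simp: d_def\<close>)
  define r s where "r = rho + d" and "s = rho - d"
  have rs: "0 < r" "r \<le> R" "0 < s" "s \<le> R" "\<bar>r - s\<bar> = 2 * d"
    using d rho by (auto simp: r_def s_def R_def)
  obtain r' where r': "r' \<in> growth_rates" "r' < r"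
    using d cInf_lessD[OF ne, of r] by (auto simp: r_def rho_def)
  then obtain C where r'0: "0 < r'" and C: "\<forall>\<^sub>F n in sequentially. N (x ^ n) \<le> C * r' ^ n"
    by (auto simp: growth_rates_def)
  \<comment> \<open>As r' < r, the quotient of \<open>x ^ n\<close> by \<open>r ^ n\<close> decays
    geometrically, and this quotient controls the distance of \<open>avg n r\<close> from 1.\<close>
  have "(\<lambda>n. r * D * (C * (r' / r) ^ n)) \<longlonglongrightarrow> r * D * (C * 0)"
    using r' r'0 rs by (intro tendsto_intros LIMSEQ_realpow_zero) auto
  then have "\<forall>\<^sub>F n in sequentially. r * D * (C * (r' / r) ^ n) < 1 / 4"
    by (rule order_tendstoD) simp
  with C eventually_gt_at_top[of 0] have "\<forall>\<^sub>F n in sequentially. N (x ^ n) \<le> 3 * s ^ n"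
  proof eventually_elim
    case (elim n)
    have rn: "of_real r ^ n \<noteq> (0::complex)" using rs by simp
    \<comment> \<open>Dividing the identity by \<open>r ^ n\<close> shows that
      \<open>avg n r - 1\<close> equals \<open>avg n r * x ^ n\<close> over \<open>r ^ n\<close>
      modulo \<open>null\<close>.\<close>
    have "scal (1 / of_real r ^ n) * (avg n r * (scal (of_real r ^ n) - x ^ n) - scal (of_real r ^ n)) \<in> null"
      by (intro null_mult avg_identity elim) auto
    also have "scal (1 / of_real r ^ n) * (avg n r * (scal (of_real r ^ n) - x ^ n) - scal (of_real r ^ n))
      = scal (1 / of_real r ^ n) * scal (of_real r ^ n) * (avg n r - 1) - scal (1 / of_real r ^ n) * (avg n r * x ^ n)"
      by (simp add: algebra_simps)
    also have "scal (1 / of_real r ^ n) * scal (of_real r ^ n) = 1"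
    proof -
      have "1 / of_real r ^ n * of_real r ^ n = (1::complex)" using rn by simp
      then show ?thesis by (simp only: scal_mult[symmetric] scal_1)
    qed
    finally have "N (avg n r - 1) = N (scal (1 / of_real r ^ n) * (avg n r * x ^ n))"
      by (intro N_cong) auto
    also have "\<dots> \<le> cmod (1 / of_real r ^ n) * N (avg n r * x ^ n)" by (intro N_scal_mult) auto
    also have "\<dots> \<le> cmod (1 / of_real r ^ n) * (N (avg n r) * N (x ^ n))"
      by (intro mult_left_mono N_mult) auto
    also have "\<dots> \<le> cmod (1 / of_real r ^ n) * ((r * D) * (C * r' ^ n))"
      using elim rs D by (intro mult_left_mono mult_mono N_avg) auto
    also have "\<dots> = r * D * (C * (r' / r) ^ n)"
      using rs by (simp add: norm_divide norm_power power_divide)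
    finally have ar: "N (avg n r - 1) \<le> 1 / 4" using elim by simp
    have "N (avg n r - avg n s) \<le> \<bar>r - s\<bar> * L"
      unfolding L_def using rs elim D by (intro N_avg_diff) auto
    also have "\<dots> \<le> 1 / 4" using d rs by simp
    finally have "N (avg n r - avg n s) \<le> 1 / 4" .
    moreover have "N (1 - avg n s) \<le> N (avg n r - avg n s) + N (avg n r - 1)"
      using N_diff[of "avg n r - avg n s" "avg n r - 1"] by simp
    ultimately have as: "N (1 - avg n s) \<le> 1 / 2" using ar by simp
    \<comment> \<open>Because \<open>avg n s\<close> is within 1 / 2 of 1, the identity at radius s
      can be solved for y: half of \<open>N y\<close> is absorbed, which gives \<open>N y\<close> at
      most 2 \<open>s ^ n\<close>.\<close>
    define y where "y = scal (of_real s ^ n) - x ^ n"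
    have y: "y \<in> A" by (simp add: y_def)
    have sn: "N (scal (of_real s ^ n)) \<le> s ^ n"
      using N_scal[of "of_real s ^ n"] rs by (simp add: norm_power)
    have "avg n s * y - scal (of_real s ^ n) \<in> null"
      unfolding y_def by (intro avg_identity elim)
    then have "N (avg n s * y) = N (scal (of_real s ^ n))"
      using y by (intro N_cong) auto
    then have "N (avg n s * y) \<le> s ^ n" using sn by simp
    moreover have "N ((1 - avg n s) * y) \<le> 1 / 2 * N y"
      using as y by (intro order_trans[OF N_mult] mult_right_mono) auto
    moreover have "N y \<le> N (avg n s * y) + N ((1 - avg n s) * y)"
      using N_add[of "avg n s * y" "(1 - avg n s) * y"] y by (simp add: algebra_simps)
    ultimately have "N y \<le> 2 * s ^ n" by simp
    moreover have "N (x ^ n) \<le> N (scal (of_real s ^ n)) + N y"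
      using N_diff[of "scal (of_real s ^ n)" y] y by (simp add: y_def)
    ultimately show "N (x ^ n) \<le> 3 * s ^ n" using sn by simp
  qed
  then have "s \<in> growth_rates" using rs by (auto simp: growth_rates_def)
  then have "rho \<le> s" unfolding rho_def by (rule cInf_lower[OF _ bdd])
  then show False using d by (simp add: s_def)
qed

end

text \<open>If every l had an inverse modulo seminorm 0, a choice of these inverses would satisfy
  the inconsistent locale above.\<close>

theorem (in complex_seminormed_algebra) spectrum_nonempty:
  assumes "x \<in> A"
  shows "\<exists>l. \<forall>g\<in>A. N (1 - (x - scal l) * g) \<noteq> 0"
proof (rule ccontr)
  assume "\<not> ?thesis"
  then obtain G where G: "\<And>l. G l \<in> A \<and> N (1 - (x - scal l) * G l) = 0" by metis
  interpret resolvent_everywhere A scal N x G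
    by unfold_locales (use G assms in \<open>auto simp: null_def\<close>)
  show False by (rule contradiction)
qed

section \<open>Invertibility in \<open>P(K)\<close> for polynomially convex \<open>K\<close>\<close>

lemma poly_fun_diff: "p \<in> poly_fun \<Longrightarrow> q \<in> poly_fun \<Longrightarrow> (\<lambda>z. p z - q z) \<in> poly_fun"
  using poly_fun.add[OF _ poly_fun.mult[OF poly_fun.const[of "- 1"]], of p q] by simp

lemma poly_fun_power: "p \<in> poly_fun \<Longrightarrow> (\<lambda>z. p z ^ n) \<in> poly_fun"
  by (induction n) (simp_all add: poly_fun.const poly_fun.mult)

lemma continuous_on_poly_fun: "p \<in> poly_fun \<Longrightarrow> continuous_on S p"
  by (induction rule: poly_fun.induct) (auto intro!: continuous_intros)

lemma poly_fun_bounded: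
  assumes "p \<in> poly_fun" "compact K"
  obtains B where "B > 0" "\<And>x. x \<in> K \<Longrightarrow> cmod (p x) \<le> B"
proof -
  have "bounded (p ` K)"
    using assms compact_continuous_image compact_imp_bounded continuous_on_poly_fun by blast
  then show ?thesis using that unfolding bounded_pos by auto
qed

lemma PX_E:
  assumes "f \<in> PX K" "e > 0"
  obtains p where "p \<in> poly_fun" "\<And>x. x \<in> K \<Longrightarrow> cmod (f x - p x) < e"
  using assms unfolding PX_def by blast

lemma poly_fun_in_PX: "p \<in> poly_fun \<Longrightarrow> p \<in> PX K"
  unfolding PX_def by (auto intro!: bexI[of _ p])

lemma PX_cong: "f \<in> PX K \<Longrightarrow> (\<And>x. x \<in> K \<Longrightarrow> f x = g x) \<Longrightarrow> g \<in> PX K"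
  unfolding PX_def by auto

lemma PX_add:
  assumes "f \<in> PX K" "g \<in> PX K"
  shows "(\<lambda>x. f x + g x) \<in> PX K"
  unfolding PX_def mem_Collect_eq
proof (intro allI impI)
  fix e :: real assume "e > 0"
  then have e: "e / 2 > 0" by simp
  obtain p where p: "p \<in> poly_fun" "\<And>x. x \<in> K \<Longrightarrow> cmod (f x - p x) < e / 2"
    using PX_E[OF assms(1) e] by blast
  obtain q where q: "q \<in> poly_fun" "\<And>x. x \<in> K \<Longrightarrow> cmod (g x - q x) < e / 2"
    using PX_E[OF assms(2) e] by blast
  have "cmod (f x + g x - (p x + q x)) < e" if "x \<in> K" for x
    using norm_diff_triangle_ineq[of "f x" "g x" "p x" "q x"] p(2)[OF that] q(2)[OF that] by simp
  then show "\<exists>p\<in>poly_fun. \<forall>x\<in>K. cmod (f x + g x - p x) < e"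
    using poly_fun.add[OF p(1) q(1)] by (intro bexI[of _ "\<lambda>x. p x + q x"]) auto
qed

lemma PX_bounded:
  assumes "f \<in> PX K" "compact K"
  obtains B where "B > 0" "\<And>x. x \<in> K \<Longrightarrow> cmod (f x) \<le> B"
proof -
  obtain p where p: "p \<in> poly_fun" "\<And>x. x \<in> K \<Longrightarrow> cmod (f x - p x) < 1"
    using PX_E[OF assms(1) zero_less_one] by blast
  obtain B where B: "B > 0" "\<And>x. x \<in> K \<Longrightarrow> cmod (p x) \<le> B"
    using poly_fun_bounded[OF p(1) assms(2)] by metis
  have "cmod (f x) \<le> B + 1" if "x \<in> K" for x
    using norm_triangle_sub[of "f x" "p x"] p(2)[OF that] B(2)[OF that] by simp
  then show ?thesis using B that[of "B + 1"] by simp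
qed

lemma norm_mult_diff_le:
  fixes a b c d :: complex
  assumes "cmod a \<le> B" "cmod d \<le> C" "cmod (a - c) \<le> e" "cmod (b - d) \<le> e'"
  shows "cmod (a * b - c * d) \<le> B * e' + e * C"
proof -
  have "a * b - c * d = a * (b - d) + (a - c) * d" by (simp add: algebra_simps)
  also have "cmod \<dots> \<le> cmod a * cmod (b - d) + cmod (a - c) * cmod d"
    unfolding norm_mult[symmetric] by (rule norm_triangle_ineq)
  also have "\<dots> \<le> B * e' + e * C"
    using assms by (intro add_mono mult_mono) (auto intro: order_trans[OF norm_ge_zero])
  finally show ?thesis .
qed

lemma PX_mult:
  assumes "f \<in> PX K" "g \<in> PX K" "compact K"
  shows "(\<lambda>x. f x * g x) \<in> PX K"
  unfolding PX_def mem_Collect_eq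
proof (intro allI impI)
  fix e :: real assume e: "e > 0"
  obtain B where B: "B > 0" "\<And>x. x \<in> K \<Longrightarrow> cmod (f x) \<le> B" using PX_bounded[OF assms(1,3)] by metis
  obtain q where q: "q \<in> poly_fun" "\<And>x. x \<in> K \<Longrightarrow> cmod (g x - q x) < e / (4 * B)"
    using PX_E[OF assms(2), of "e / (4 * B)"] e B by auto
  \<comment> \<open>The approximation q is fixed before p, because its bound C sets the tolerance
    for p.\<close>
  obtain C where C: "C > 0" "\<And>x. x \<in> K \<Longrightarrow> cmod (q x) \<le> C" using poly_fun_bounded[OF q(1) assms(3)] by metis
  obtain p where p: "p \<in> poly_fun" "\<And>x. x \<in> K \<Longrightarrow> cmod (f x - p x) < e / (4 * C)"
    using PX_E[OF assms(1), of "e / (4 * C)"] e C by auto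
  have "cmod (f x * g x - p x * q x) < e" if "x \<in> K" for x
  proof -
    have "cmod (f x * g x - p x * q x) \<le> B * (e / (4 * B)) + e / (4 * C) * C"
      using B(2) C(2) p(2) q(2) that by (intro norm_mult_diff_le) (auto intro: less_imp_le)
    also have "\<dots> = e / 2" using B(1) C(1) by simp
    finally show ?thesis using e by simp
  qed
  then show "\<exists>p\<in>poly_fun. \<forall>x\<in>K. cmod (f x * g x - p x) < e"
    using poly_fun.mult[OF p(1) q(1)] by (intro bexI[of _ "\<lambda>x. p x * q x"]) auto
qed

lemma PX_diff:
  assumes "f \<in> PX K" "g \<in> PX K" "compact K"
  shows "(\<lambda>x. f x - g x) \<in> PX K"
  using PX_add[OF assms(1) PX_mult[OF poly_fun_in_PX[OF poly_fun.const[of "- 1"]] assms(2,3)]] by simp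

lemma PX_closed:
  assumes "\<And>e. e > 0 \<Longrightarrow> \<exists>g\<in>PX K. \<forall>x\<in>K. cmod (f x - g x) < e"
  shows "f \<in> PX K"
  unfolding PX_def mem_Collect_eq
proof (intro allI impI)
  fix e :: real assume "e > 0"
  then obtain g where g: "g \<in> PX K" "\<And>x. x \<in> K \<Longrightarrow> cmod (f x - g x) < e / 2"
    using assms[of "e / 2"] by auto
  then obtain p where p: "p \<in> poly_fun" "\<And>x. x \<in> K \<Longrightarrow> cmod (g x - p x) < e / 2"
    using PX_E[OF g(1), of "e / 2"] \<open>e > 0\<close> by auto
  have "cmod (f x - p x) < e" if "x \<in> K" for x
    using norm_triangle_ineq[of "f x - g x" "g x - p x"] g(2)[OF that] p(2)[OF that] by simp
  with p show "\<exists>p\<in>poly_fun. \<forall>x\<in>K. cmod (f x - p x) < e" by auto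
qed

lemma PX_sum_powers:
  assumes "f \<in> PX K" "compact K"
  shows "(\<lambda>x. \<Sum>k<n. f x ^ k) \<in> PX K"
proof -
  have pow: "(\<lambda>x. f x ^ k) \<in> PX K" for k
  proof (induction k)
    case 0
    show ?case using poly_fun_in_PX[OF poly_fun.const[of 1]] by simp
  next
    case (Suc k)
    show ?case using PX_mult[OF assms(1) Suc assms(2)] by simp
  qed
  show ?thesis
  proof (induction n)
    case 0
    show ?case using poly_fun_in_PX[OF poly_fun.const[of 0]] by simp
  next
    case (Suc n)
    show ?case using PX_add[OF Suc pow[of n]] by simp
  qed
qed

text \<open>Neumann series: the partial sums of the powers of 1 - f miss 1 / f by exactly
  \<open>(1 - f) ^ n / f\<close>, which is uniformly small.\<close>

lemma PX_inverse:
  assumes "f \<in> PX K" "compact K" "c < 1" "\<And>x. x \<in> K \<Longrightarrow> cmod (1 - f x) \<le> c"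
  shows "(\<lambda>x. inverse (f x)) \<in> PX K"
proof (rule PX_closed)
  fix e :: real assume e: "e > 0"
  \<comment> \<open>For empty K the constant c may be negative; d is a nonnegative
    substitute.\<close>
  define d where "d = max c 0"
  have d: "0 \<le> d" "d < 1" "\<And>x. x \<in> K \<Longrightarrow> cmod (1 - f x) \<le> d"
    using assms by (auto simp: d_def le_max_iff_disj)
  have "(\<lambda>n. d ^ n / (1 - d)) \<longlonglongrightarrow> 0 / (1 - d)"
    using d by (intro tendsto_divide LIMSEQ_realpow_zero) auto
  then have "\<forall>\<^sub>F n in sequentially. d ^ n / (1 - d) < e" by (rule order_tendstoD) (simp add: e)
  then obtain n where n: "d ^ n / (1 - d) < e" by (auto simp: eventually_sequentially)
  have "cmod (inverse (f x) - (\<Sum>k<n. (1 - f x) ^ k)) < e" if x: "x \<in> K" for x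
  proof -
    have nf: "1 - d \<le> cmod (f x)"
      using norm_triangle_ineq2[of 1 "1 - f x"] d(3)[OF x] by simp
    then have fx: "f x \<noteq> 0" using d by auto
    have "(\<Sum>k<n. (1 - f x) ^ k) = (1 - (1 - f x) ^ n) / f x"
      using fx by (subst geometric_sum) (auto simp: field_simps)
    then have "inverse (f x) - (\<Sum>k<n. (1 - f x) ^ k) = (1 - f x) ^ n / f x"
      using fx by (simp add: field_simps)
    then have "cmod (inverse (f x) - (\<Sum>k<n. (1 - f x) ^ k)) = cmod (1 - f x) ^ n / cmod (f x)"
      by (simp add: norm_divide norm_power)
    also have "\<dots> \<le> d ^ n / (1 - d)"
      using d nf x by (intro frac_le power_mono) auto
    finally show ?thesis using n by simp
  qed
  moreover have "(\<lambda>x. \<Sum>k<n. (1 - f x) ^ k) \<in> PX K"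
    by (rule PX_sum_powers[OF PX_diff[OF poly_fun_in_PX[OF poly_fun.const] assms(1,2)] assms(2)])
  ultimately show "\<exists>g\<in>PX K. \<forall>x\<in>K. cmod (inverse (f x) - g x) < e"
    by (intro bexI[of _ "\<lambda>x. \<Sum>k<n. (1 - f x) ^ k"] ballI)
qed

section \<open>Proper ideals of P(K) and their quotient seminorms\<close>

definition PX_ideal :: "(complex^'n) set \<Rightarrow> (complex^'n \<Rightarrow> complex) set \<Rightarrow> bool" where
  "PX_ideal K J \<longleftrightarrow> J \<subseteq> PX K \<and> {f. \<forall>x\<in>K. f x = 0} \<subseteq> J \<and> (\<forall>f\<in>J. \<forall>g\<in>J. f + g \<in> J) \<and>
     (\<forall>f\<in>PX K. \<forall>g\<in>J. f * g \<in> J)"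

text \<open>An element closer than 1 to the constant 1 has an inverse in P(K), so no proper ideal
  contains it. The product with the inverse equals 1 only on K; the correction vanishes on K and
  lies in J, as \<open>PX_ideal\<close> puts all such functions into every ideal.\<close>

lemma PX_ideal_proper:
  assumes J: "PX_ideal K J" "1 \<notin> J" and K: "compact K" and j: "j \<in> J"
    and c: "\<And>x. x \<in> K \<Longrightarrow> cmod (1 - j x) \<le> c"
  shows "1 \<le> c"
proof (rule ccontr)
  assume "\<not> 1 \<le> c"
  then have c1: "c < 1" by simp
  have jP: "j \<in> PX K" using J j by (auto simp: PX_ideal_def)
  have "(\<lambda>x. inverse (j x)) \<in> PX K" using PX_inverse[OF jP K c1 c] .
  then have "(\<lambda>x. inverse (j x)) * j \<in> J" using J j by (auto simp: PX_ideal_def)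
  moreover have "1 - (\<lambda>x. inverse (j x)) * j \<in> J"
  proof -
    have "j x \<noteq> 0" if "x \<in> K" for x using c[OF that] c1 by auto
    then have "1 - (\<lambda>x. inverse (j x)) * j \<in> {f. \<forall>x\<in>K. f x = 0}" by simp
    then show ?thesis using J by (auto simp: PX_ideal_def)
  qed
  ultimately have "(\<lambda>x. inverse (j x)) * j + (1 - (\<lambda>x. inverse (j x)) * j) \<in> J"
    using J unfolding PX_ideal_def by blast
  then show False using J by simp
qed

text \<open>The uniform distance on K from f to J, written as an infimum of upper bounds so that no
  supremum over K has to be formed.\<close>

definition quotient_norm :: "(complex^'n) set \<Rightarrow> (complex^'n \<Rightarrow> complex) set \<Rightarrow> (complex^'n \<Rightarrow> complex) \<Rightarrow> real" where
  "quotient_norm K J f = Inf {c. \<exists>j\<in>J. \<forall>x\<in>K. cmod (f x - j x) \<le> c}"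

text \<open>Properness of J enters in the bound 1 <= N 1, through \<open>PX_ideal_proper\<close>. A
  point of K makes all the upper bounds nonnegative.\<close>

lemma quotient_norm_algebra:
  assumes J: "PX_ideal K J" "1 \<notin> J" and K: "compact K" "K \<noteq> {}"
  shows "complex_seminormed_algebra (PX K) (\<lambda>c x. c) (quotient_norm K J)"
    and "\<And>f. f \<in> J \<Longrightarrow> quotient_norm K J f = 0"
proof -
  let ?N = "quotient_norm K J"
  let ?B = "\<lambda>f. {c. \<exists>j\<in>J. \<forall>x\<in>K. cmod (f x - j x) \<le> c}"
  have J0: "0 \<in> J" and Jadd: "\<And>f g. f \<in> J \<Longrightarrow> g \<in> J \<Longrightarrow> f + g \<in> J"
    and Jmult: "\<And>f g. f \<in> PX K \<Longrightarrow> g \<in> J \<Longrightarrow> f * g \<in> J" and JP: "\<And>f. f \<in> J \<Longrightarrow> f \<in> PX K"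
    using J(1) by (auto simp: PX_ideal_def)
  obtain x0 where x0: "x0 \<in> K" using K by auto
  have nonneg: "0 \<le> c" if "c \<in> ?B f" for c f
    using that x0 by (auto intro: order_trans[OF norm_ge_zero])
  have bdd: "bdd_below (?B f)" for f by (rule bdd_belowI[of _ 0]) (rule nonneg)
  have le: "?N f \<le> c" if "j \<in> J" "\<And>x. x \<in> K \<Longrightarrow> cmod (f x - j x) \<le> c" for f j c
    unfolding quotient_norm_def using that by (intro cInf_lower bdd) auto
  have ne: "?B f \<noteq> {}" if "f \<in> PX K" for f
  proof -
    obtain B where "\<And>x. x \<in> K \<Longrightarrow> cmod (f x) \<le> B" using PX_bounded[OF \<open>f \<in> PX K\<close> K(1)] by metis
    then have "\<forall>x\<in>K. cmod (f x - 0 x) \<le> B" by simp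
    then show ?thesis using J0 by blast
  qed
  have Nge: "c \<le> ?N f" if "f \<in> PX K" "\<And>b j. j \<in> J \<Longrightarrow> (\<And>x. x \<in> K \<Longrightarrow> cmod (f x - j x) \<le> b) \<Longrightarrow> c \<le> b" for c f
    unfolding quotient_norm_def using that by (intro cInf_greatest ne) auto
  have less: "\<exists>j\<in>J. \<forall>x\<in>K. cmod (f x - j x) \<le> c" if "f \<in> PX K" "?N f < c" for f c
    using cInf_lessD[OF ne[OF that(1)] that(2)[unfolded quotient_norm_def]] by force
  have N0: "0 \<le> ?N f" if "f \<in> PX K" for f
    unfolding quotient_norm_def using that nonneg by (intro cInf_greatest ne)
  show null: "?N f = 0" if "f \<in> J" for f
    using le[OF that, of f 0] N0[OF JP[OF that]] by simp
  show "complex_seminormed_algebra (PX K) (\<lambda>c x. c) ?N"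
  proof
    show "?N (f + g) \<le> ?N f + ?N g" if f: "f \<in> PX K" and g: "g \<in> PX K" for f g
    proof (rule field_le_epsilon)
      fix e :: real assume e: "e > 0"
      obtain i j where i: "i \<in> J" "\<And>x. x \<in> K \<Longrightarrow> cmod (f x - i x) \<le> ?N f + e / 2"
        and j: "j \<in> J" "\<And>x. x \<in> K \<Longrightarrow> cmod (g x - j x) \<le> ?N g + e / 2"
        using less[OF f, of "?N f + e / 2"] less[OF g, of "?N g + e / 2"] e by auto
      show "?N (f + g) \<le> ?N f + ?N g + e"
      proof (rule le[OF Jadd[OF i(1) j(1)]])
        fix x assume "x \<in> K"
        then show "cmod ((f + g) x - (i + j) x) \<le> ?N f + ?N g + e"
          using norm_diff_triangle_ineq[of "f x" "g x" "i x" "j x"] i(2)[of x] j(2)[of x] by simp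
      qed
    qed
    show "?N (f * g) \<le> ?N f * ?N g" if f: "f \<in> PX K" and g: "g \<in> PX K" for f g
    proof -
      have *: "?N (f * g) \<le> (?N f + e) * (?N g + e)" if e: "e > 0" for e
      proof -
        obtain i j where i: "i \<in> J" "\<And>x. x \<in> K \<Longrightarrow> cmod (f x - i x) \<le> ?N f + e"
          and j: "j \<in> J" "\<And>x. x \<in> K \<Longrightarrow> cmod (g x - j x) \<le> ?N g + e"
          using less[OF f, of "?N f + e"] less[OF g, of "?N g + e"] e by auto
        \<comment> \<open>This is the element of J by which f g differs from (f - i) (g -
          j).\<close>
        have "(\<lambda>x. g x - j x) * i + f * j \<in> J"
          using Jadd[OF Jmult[OF PX_diff[OF g JP[OF j(1)] K(1)] i(1)] Jmult[OF f j(1)]] .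
        then show ?thesis
        proof (rule le)
          fix x assume x: "x \<in> K"
          have "(f * g) x - ((\<lambda>x. g x - j x) * i + f * j) x = (f x - i x) * (g x - j x)"
            by (simp add: algebra_simps)
          then have "cmod ((f * g) x - ((\<lambda>x. g x - j x) * i + f * j) x) = cmod (f x - i x) * cmod (g x - j x)"
            by (simp only: norm_mult)
          also have "\<dots> \<le> (?N f + e) * (?N g + e)"
            using i(2)[OF x] j(2)[OF x] N0[OF f] e by (intro mult_mono) auto
          finally show "cmod ((f * g) x - ((\<lambda>x. g x - j x) * i + f * j) x) \<le> (?N f + e) * (?N g + e)" .
        qed
      qed
      have "((\<lambda>e. (?N f + e) * (?N g + e)) \<longlongrightarrow> (?N f + 0) * (?N g + 0)) (at_right 0)"
        by (intro tendsto_intros)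
      moreover have "\<forall>\<^sub>F e in at_right 0. ?N (f * g) \<le> (?N f + e) * (?N g + e)"
        using eventually_at_right_less[of "0::real"] by eventually_elim (rule *)
      ultimately show ?thesis
        by (intro tendsto_lowerbound[of "\<lambda>e. (?N f + e) * (?N g + e)" _ "at_right 0"]) auto
    qed
    show "?N (\<lambda>x. a) \<le> cmod a" for a by (rule le[OF J0]) auto
    show "1 \<le> ?N 1"
    proof (rule Nge)
      show "1 \<in> PX K" unfolding one_fun_def by (intro poly_fun_in_PX poly_fun.const)
    qed (rule PX_ideal_proper[OF J K(1)], auto)
    show "(\<lambda>x. a) \<in> PX K" for a by (intro poly_fun_in_PX poly_fun.const)
    show "f + g \<in> PX K" if "f \<in> PX K" "g \<in> PX K" for f g
      using PX_add[OF that] by (simp add: plus_fun_def)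
    show "f * g \<in> PX K" if "f \<in> PX K" "g \<in> PX K" for f g
      using PX_mult[OF that K(1)] by (simp add: times_fun_def)
  qed (auto intro: N0)
qed

text \<open>Take l in the spectrum of f modulo J and adjoin f - l to J. If the enlarged ideal
  contained 1, then f - l would be invertible modulo J.\<close>

lemma PX_ideal_extend:
  assumes J: "PX_ideal K J" "1 \<notin> J" and K: "compact K" "K \<noteq> {}" and f: "f \<in> PX K"
  obtains l J' where "PX_ideal K J'" "1 \<notin> J'" "J \<subseteq> J'" "(\<lambda>x. f x - l) \<in> J'"
proof -
  interpret complex_seminormed_algebra "PX K" "\<lambda>c x. c" "quotient_norm K J"
    by (rule quotient_norm_algebra[OF J K])
  obtain l where l: "\<And>g. g \<in> PX K \<Longrightarrow> quotient_norm K J (1 - (f - (\<lambda>x. l)) * g) \<noteq> 0"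
    using spectrum_nonempty[OF f] by auto
  have J0: "{f. \<forall>x\<in>K. f x = 0} \<subseteq> J" and Jadd: "\<And>f g. f \<in> J \<Longrightarrow> g \<in> J \<Longrightarrow> f + g \<in> J"
    and Jmult: "\<And>f g. f \<in> PX K \<Longrightarrow> g \<in> J \<Longrightarrow> f * g \<in> J" and JP: "\<And>f. f \<in> J \<Longrightarrow> f \<in> PX K"
    using J(1) by (auto simp: PX_ideal_def)
  define J' where "J' = {j + (f - (\<lambda>x. l)) * g | j g. j \<in> J \<and> g \<in> PX K}"
  have fl: "f - (\<lambda>x. l) \<in> PX K" by (intro diff_in f scal_in)
  have J'I: "j + (f - (\<lambda>x. l)) * g \<in> J'" if "j \<in> J" "g \<in> PX K" for j g
    using that by (auto simp: J'_def)
  have sub: "J \<subseteq> J'" using J'I[OF _ zero_in] by auto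
  show ?thesis
  proof (rule that[of J' l])
    show "PX_ideal K J'" unfolding PX_ideal_def
    proof (intro conjI ballI)
      show "J' \<subseteq> PX K" using fl JP unfolding J'_def by blast
      show "{f. \<forall>x\<in>K. f x = 0} \<subseteq> J'" using J0 sub by blast
    next
      fix u v assume "u \<in> J'" "v \<in> J'"
      then obtain j g i h where *: "j \<in> J" "g \<in> PX K" "i \<in> J" "h \<in> PX K"
        and u: "u = j + (f - (\<lambda>x. l)) * g" and v: "v = i + (f - (\<lambda>x. l)) * h"
        unfolding J'_def by blast
      have "u + v = (j + i) + (f - (\<lambda>x. l)) * (g + h)" unfolding u v by (simp only: algebra_simps)
      also have "\<dots> \<in> J'" using * by (intro J'I Jadd add_in)
      finally show "u + v \<in> J'" .
    next
      fix u v assume u: "u \<in> PX K" and "v \<in> J'"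
      then obtain j g where *: "j \<in> J" "g \<in> PX K" and v: "v = j + (f - (\<lambda>x. l)) * g"
        unfolding J'_def by blast
      have "u * v = u * j + (f - (\<lambda>x. l)) * (u * g)" unfolding v by (simp only: algebra_simps)
      also have "\<dots> \<in> J'" using * u by (intro J'I Jmult mult_in)
      finally show "u * v \<in> J'" .
    qed
    show "1 \<notin> J'"
    proof
      assume "1 \<in> J'"
      then obtain j g where *: "j \<in> J" "g \<in> PX K" "1 = j + (f - (\<lambda>x. l)) * g"
        unfolding J'_def by blast
      then have "1 - (f - (\<lambda>x. l)) * g = j" by (metis add_diff_cancel_right')
      then show False using l[OF *(2)] quotient_norm_algebra(2)[OF J K *(1)] by simp
    qed
    show "J \<subseteq> J'" by (rule sub)
    have "0 + (f - (\<lambda>x. l)) * 1 \<in> J'" using J0 by (intro J'I one_in) auto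
    moreover have "0 + (f - (\<lambda>x. l)) * 1 = (\<lambda>x. f x - l)" by (simp add: fun_eq_iff)
    ultimately show "(\<lambda>x. f x - l) \<in> J'" by simp
  qed
qed

text \<open>The finitely many coordinates are adjoined one at a time, each shifted by a spectral
  value. The resulting ideal does the work of a maximal ideal without an appeal to Zorn's
  lemma.\<close>

lemma PX_ideal_contains_point_ideal:
  fixes K :: "(complex^'n) set"
  assumes J: "PX_ideal K J" "1 \<notin> J" and K: "compact K" "K \<noteq> {}"
  shows "\<exists>(l :: complex^'n) J'. PX_ideal K J' \<and> 1 \<notin> J' \<and> J \<subseteq> J' \<and> (\<forall>i. (\<lambda>x. x $ i - l $ i) \<in> J')"
proof -
  have "\<exists>l J'. PX_ideal K J' \<and> 1 \<notin> J' \<and> J \<subseteq> J' \<and> (\<forall>i\<in>S. (\<lambda>x. x $ i - l i) \<in> J')"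
    for S :: "'n set"
    using finite[of S]
  proof (induction S rule: finite_induct)
    case empty
    then show ?case using J by blast
  next
    case (insert a S)
    then obtain l J' where J': "PX_ideal K J'" "1 \<notin> J'" "J \<subseteq> J'" "\<forall>i\<in>S. (\<lambda>x. x $ i - l i) \<in> J'"
      by blast
    obtain m J'' where J'': "PX_ideal K J''" "1 \<notin> J''" "J' \<subseteq> J''" "(\<lambda>x. x $ a - m) \<in> J''"
      using PX_ideal_extend[OF J'(1,2) K poly_fun_in_PX[OF poly_fun.coord[of a]]] by blast
    have "\<forall>i\<in>insert a S. (\<lambda>x. x $ i - (l(a := m)) i) \<in> J''"
      using J' J'' insert.hyps by auto
    then show ?case using J'(3) J''(1-3) by blast
  qed
  from this[of UNIV] obtain l J' where "PX_ideal K J'" "1 \<notin> J'" "J \<subseteq> J'"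
    "\<forall>i. (\<lambda>x. x $ i - l i) \<in> J'" by blast
  then show ?thesis by (intro exI[of _ "\<chi> i. l i"] exI[of _ J']) simp
qed

text \<open>This replaces the Oka--Weil theorem: the maximal ideals of \<open>P(K)\<close> are the points of the
  polynomial hull of \<open>K\<close>.\<close>

theorem poly_fun_invertible_on_poly_convex:
  fixes K :: "(complex^'n) set"
  assumes K: "compact K" "poly_hull K = K" and p: "p \<in> poly_fun" "\<And>z. z \<in> K \<Longrightarrow> p z \<noteq> 0"
  shows "\<exists>g\<in>PX K. \<forall>x\<in>K. p x * g x = 1"
proof (cases "K = {}")
  case True
  then show ?thesis using poly_fun_in_PX[OF p(1)] by auto
next
  case ne: False
  show ?thesis
  proof (rule ccontr)
    assume not_inv: "\<not> ?thesis"
    \<comment> \<open>The ideal generated by p, which is proper exactly because p has no inverse in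
      P(K).\<close>
    define J where "J = {f \<in> PX K. \<exists>g\<in>PX K. \<forall>x\<in>K. f x = p x * g x}"
    have zero: "(\<lambda>x. 0) \<in> PX K" by (intro poly_fun_in_PX poly_fun.const)
    have J: "PX_ideal K J" unfolding PX_ideal_def
    proof (intro conjI ballI)
      show "J \<subseteq> PX K" by (auto simp: J_def)
      show "{f. \<forall>x\<in>K. f x = 0} \<subseteq> J"
      proof
        fix f :: "complex^'n \<Rightarrow> complex" assume "f \<in> {f. \<forall>x\<in>K. f x = 0}"
        then have f: "\<forall>x\<in>K. f x = 0" by simp
        then have "f \<in> PX K" by (intro PX_cong[OF zero]) simp
        with f zero show "f \<in> J" unfolding J_def by fastforce
      qed
    next
      fix u v assume "u \<in> J" "v \<in> J"
      then obtain g h where *: "u \<in> PX K" "v \<in> PX K" "g \<in> PX K" "h \<in> PX K"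
        "\<forall>x\<in>K. u x = p x * g x" "\<forall>x\<in>K. v x = p x * h x"
        by (auto simp: J_def)
      then show "u + v \<in> J" using PX_add[OF *(1,2)] PX_add[OF *(3,4)]
        unfolding J_def plus_fun_def
        by (intro CollectI conjI bexI[of _ "\<lambda>x. g x + h x"] ballI) (auto simp: algebra_simps)
    next
      fix u v assume u: "u \<in> PX K" and "v \<in> J"
      then obtain g where *: "v \<in> PX K" "g \<in> PX K" "\<forall>x\<in>K. v x = p x * g x"
        by (auto simp: J_def)
      then show "u * v \<in> J" using PX_mult[OF u *(1) K(1)] PX_mult[OF u *(2) K(1)]
        unfolding J_def times_fun_def
        by (intro CollectI conjI bexI[of _ "\<lambda>x. u x * g x"] ballI) (auto simp: algebra_simps)
    qed
    have "1 \<notin> J" using not_inv by (auto simp: J_def)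
    then obtain l J' where J': "PX_ideal K J'" "1 \<notin> J'" "J \<subseteq> J'" and
      l': "\<forall>i. (\<lambda>x. x $ i - l $ i) \<in> J'"
      using PX_ideal_contains_point_ideal[OF J _ K(1) ne] by metis
    have l: "(\<lambda>x. x $ i - l $ i) \<in> J'" for i using l' by (rule spec)
    have Jadd: "f + g \<in> J'" if "f \<in> J'" "g \<in> J'" for f g
      using J'(1) that unfolding PX_ideal_def by blast
    have Jmult: "f * g \<in> J'" if "f \<in> PX K" "g \<in> J'" for f g
      using J'(1) that unfolding PX_ideal_def by blast
    have const_mult: "(\<lambda>x. c * f x) \<in> J'" if "f \<in> J'" for c f
      using Jmult[OF poly_fun_in_PX[OF poly_fun.const[of c]] that] by (simp add: times_fun_def)
    \<comment> \<open>Modulo J' every polynomial is congruent to its value at l, so J' defines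
      evaluation at l.\<close>
    have point: "(\<lambda>x. f x - f l) \<in> J'" if "f \<in> poly_fun" for f
      using that
    proof induction
      case (const c)
      have "(\<lambda>x. 0) \<in> J'" using J'(1) by (auto simp: PX_ideal_def)
      then show ?case by simp
    next
      case (coord i)
      then show ?case by (rule l)
    next
      case (add f g)
      have "(\<lambda>x. f x - f l) + (\<lambda>x. g x - g l) \<in> J'" by (rule Jadd[OF add.IH])
      then show ?case by (simp add: plus_fun_def algebra_simps)
    next
      case (mult f g)
      have "f * (\<lambda>x. g x - g l) + (\<lambda>x. g l * (f x - f l)) \<in> J'"
        by (rule Jadd[OF Jmult[OF poly_fun_in_PX[OF mult.hyps(1)] mult.IH(2)] const_mult[OF mult.IH(1)]])
      then show ?case by (simp add: plus_fun_def times_fun_def algebra_simps)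
    qed
    have "p \<in> J'"
    proof -
      have "(\<lambda>x. 1) \<in> PX K" by (intro poly_fun_in_PX poly_fun.const)
      then have "p \<in> J" using poly_fun_in_PX[OF p(1)] unfolding J_def by force
      then show ?thesis using J' by blast
    qed
    \<comment> \<open>Both p and p - p(l) lie in J', hence so does the constant p(l). If it were
      nonzero, scaling would put 1 into J'.\<close>
    then have "p + (\<lambda>x. (- 1) * (p x - p l)) \<in> J'" using Jadd const_mult[OF point[OF p(1)]] by blast
    then have "(\<lambda>x. inverse (p l) * (p + (\<lambda>x. (- 1) * (p x - p l))) x) \<in> J'" by (rule const_mult)
    then have pl: "p l = 0" using J'(2) unfolding one_fun_def by (cases "p l = 0") auto
    have "l \<in> poly_hull K" unfolding poly_hull_def
    proof (intro CollectI ballI, rule ccontr)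
      fix f assume f: "f \<in> poly_fun" and "\<not> (\<exists>x\<in>K. cmod (f l) \<le> cmod (f x))"
      then have less: "cmod (f x) < cmod (f l)" if "x \<in> K" for x using that by force
      have fl: "f l \<noteq> 0" using less ne by fastforce
      obtain y where y: "y \<in> K" "\<And>x. x \<in> K \<Longrightarrow> cmod (f x) \<le> cmod (f y)"
        using continuous_attains_sup[OF K(1) ne, of "\<lambda>x. cmod (f x)"]
          continuous_on_norm[OF continuous_on_poly_fun[OF f]] by blast
      \<comment> \<open>This element of J' is 1 - f / f(l). Its distance from 1 on K is the maximum
        of |f| divided by |f(l)|, which \<open>PX_ideal_proper\<close> forces to be at least
        1.\<close>
      have "(\<lambda>x. (- inverse (f l)) * (f x - f l)) \<in> J'" by (rule const_mult[OF point[OF f]])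
      then have "1 \<le> cmod (f y) / cmod (f l)"
      proof (rule PX_ideal_proper[OF J'(1,2) K(1)])
        fix x assume x: "x \<in> K"
        have "1 - (- inverse (f l)) * (f x - f l) = f x / f l" using fl by (simp add: field_simps)
        then show "cmod (1 - (- inverse (f l)) * (f x - f l)) \<le> cmod (f y) / cmod (f l)"
          using y(2)[OF x] by (simp only: norm_divide divide_right_mono norm_ge_zero)
      qed
      then show False using less[OF y(1)] fl by simp
    qed
    then show False using p(2)[of l] pl K by auto
  qed
qed

corollary poly_fun_approx_inverse:
  fixes K :: "(complex^'n) set"
  assumes K: "compact K" "poly_hull K = K" and p: "p \<in> poly_fun" "\<And>z. z \<in> K \<Longrightarrow> p z \<noteq> 0"
    and e: "e > 0"
  obtains q where "q \<in> poly_fun" "\<And>x. x \<in> K \<Longrightarrow> cmod (1 - p x * q x) < e"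
proof -
  obtain g where g: "g \<in> PX K" "\<And>x. x \<in> K \<Longrightarrow> p x * g x = 1"
    using poly_fun_invertible_on_poly_convex[OF K p] by auto
  obtain B where B: "B > 0" "\<And>x. x \<in> K \<Longrightarrow> cmod (p x) \<le> B" using poly_fun_bounded[OF p(1) K(1)] by metis
  obtain q where q: "q \<in> poly_fun" "\<And>x. x \<in> K \<Longrightarrow> cmod (g x - q x) < e / B"
    using PX_E[OF g(1), of "e / B"] e B by auto
  have "cmod (1 - p x * q x) < e" if x: "x \<in> K" for x
  proof -
    have "1 - p x * q x = p x * (g x - q x)" using g(2)[OF x] by (simp add: algebra_simps)
    then have "cmod (1 - p x * q x) = cmod (p x) * cmod (g x - q x)" by (simp only: norm_mult)
    also have "\<dots> \<le> B * cmod (g x - q x)" using B(2)[OF x] by (intro mult_right_mono) auto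
    also have "\<dots> < B * (e / B)" using q(2)[OF x] B by (intro mult_strict_left_mono)
    finally show ?thesis using B by simp
  qed
  then show ?thesis using q that by blast
qed

section \<open>The nested construction\<close>

lemma one_plus_power_near_one: "cmod ((1 + a) ^ n - 1) \<le> (1 + cmod a) ^ n - 1"
proof (induction n)
  case (Suc n)
  have "(1 + a) ^ Suc n - 1 = ((1 + a) ^ n - 1) * (1 + a) + a" by (simp add: algebra_simps)
  also have "cmod \<dots> \<le> cmod ((1 + a) ^ n - 1) * cmod (1 + a) + cmod a"
    by (metis norm_mult norm_triangle_ineq)
  also have "\<dots> \<le> ((1 + cmod a) ^ n - 1) * (1 + cmod a) + cmod a"
    using Suc norm_triangle_ineq[of 1 a] by (intro add_mono mult_mono) auto
  finally show ?case by (simp add: algebra_simps)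
qed simp

text \<open>\<open>(1 + 12 * (w - 1) / n) ^ n\<close> approximates \<open>exp (12 * (w - 1))\<close>.\<close>

lemma exp_like_small:
  assumes n: "n > 0" "72 * (M + 1)\<^sup>2 \<le> real n" and w: "Re w \<le> 1 / 2" "cmod w \<le> M"
  shows "cmod ((1 + of_real (12 / real n) * (w - 1)) ^ n) \<le> 1 / 10"
proof -
  define t where "t = 12 / real n"
  let ?u = "1 + of_real t * (w - 1)"
  have "cmod (w - 1) \<le> M + 1" using norm_triangle_ineq4[of w 1] w by simp
  then have c: "(cmod (w - 1))\<^sup>2 \<le> (M + 1)\<^sup>2" by (intro power_mono) auto
  have "(cmod ?u)\<^sup>2 = 1 + 2 * t * (Re w - 1) + t\<^sup>2 * (cmod (w - 1))\<^sup>2"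
    unfolding cmod_power2 by (simp add: power2_eq_square algebra_simps)
  \<comment> \<open>The linear term contributes at most -12 / n, and the lower bound on n limits the
    quadratic term to 2 / n, which leaves 1 - 10 / n.\<close>
  also have "\<dots> \<le> 1 + 2 * t * (- 1 / 2) + t\<^sup>2 * (real n / 72)"
    using w n c by (intro add_mono mult_left_mono) (auto simp: t_def)
  also have "\<dots> = 1 - 10 / real n" using n by (simp add: t_def field_simps power2_eq_square)
  also have "\<dots> \<le> exp (- (10 / real n))" using exp_ge_add_one_self[of "- (10 / real n)"] by simp
  finally have "((cmod ?u)\<^sup>2) ^ n \<le> exp (- (10 / real n)) ^ n" by (intro power_mono) auto
  also have "\<dots> = exp (- 10)" using n by (simp add: exp_of_nat_mult[symmetric])
  also have "exp (- 10) \<le> (1 / 10 :: real)\<^sup>2"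
  proof -
    have "(2::real) ^ 10 \<le> exp 1 ^ 10" using exp_ge_add_one_self[of 1] by (intro power_mono) auto
    also have "\<dots> = exp 10" by (simp add: exp_of_nat_mult[symmetric])
    finally show ?thesis by (simp add: exp_minus field_simps)
  qed
  finally have "(cmod (?u ^ n))\<^sup>2 \<le> (1 / 10)\<^sup>2"
    by (simp add: norm_power power_mult[symmetric] mult.commute t_def)
  then show ?thesis unfolding t_def by (rule power2_le_imp_le) simp
qed

text \<open>The total exponent has modulus at most 12 / 300 = 1 / 25, so the deviation from 1 is at
  most exp (1 / 25) - 1, whatever n is.\<close>

lemma exp_like_near_one:
  assumes n: "n > 0" and w: "cmod (w - 1) \<le> 1 / 300"
  shows "cmod (1 - (1 + of_real (12 / real n) * (w - 1)) ^ n) \<le> 1 / 10"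
proof -
  let ?a = "of_real (12 / real n) * (w - 1)"
  have "cmod ?a \<le> 12 / real n * (1 / 300)"
    using w n by (simp only: norm_mult norm_of_real) (intro mult_mono, auto)
  then have "cmod ?a \<le> 1 / 25 / real n" by simp
  then have "1 + cmod ?a \<le> exp (1 / 25 / real n)"
    using exp_ge_add_one_self[of "1 / 25 / real n"] by linarith
  then have "(1 + cmod ?a) ^ n \<le> exp (1 / 25 / real n) ^ n" by (intro power_mono) auto
  also have "\<dots> = exp (1 / 25)" using n by (simp add: exp_of_nat_mult[symmetric])
  also have "\<dots> \<le> 1 + 1 / 25 + (1 / 25)\<^sup>2" by (rule exp_bound) auto
  finally have "(1 + cmod ?a) ^ n - 1 \<le> 1 / 10" by (simp add: power2_eq_square)
  then show ?thesis using one_plus_power_near_one[of ?a n] by (simp add: norm_minus_commute)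
qed

text \<open>The smoothstep polynomial has superattracting fixed points 0 and 1, exchanged by
  \<open>u \<mapsto> 1 - u\<close>.\<close>

definition smoothstep :: "complex \<Rightarrow> complex" where
  "smoothstep u = u ^ 2 * (3 - 2 * u)"

lemma smoothstep_flip: "1 - smoothstep u = smoothstep (1 - u)"
  by (simp add: smoothstep_def power2_eq_square algebra_simps)

lemma smoothstep_iterate_small:
  assumes "cmod u \<le> 1 / 10"
  shows "cmod ((smoothstep ^^ m) u) \<le> (1 / 2) ^ m / 10"
proof (induction m)
  case (Suc m)
  define v where "v = (smoothstep ^^ m) u"
  have v: "cmod v \<le> (1 / 2) ^ m / 10" using Suc by (simp add: v_def)
  have v1: "cmod v \<le> 1 / 10" using v power_le_one[of "1 / 2 :: real" m] by simp
  have "cmod (smoothstep v) = cmod v * (cmod v * cmod (3 - 2 * v))"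
    by (simp add: smoothstep_def norm_mult power2_eq_square)
  \<comment> \<open>Since |v| <= 1 / 10 and |3 - 2 v| <= 5, every iteration at least halves the
    modulus.\<close>
  also have "\<dots> \<le> cmod v * (1 / 10 * 5)"
    using v1 norm_triangle_ineq4[of 3 "2 * v"] by (intro mult_left_mono mult_mono) (auto simp: norm_mult)
  finally show ?case using v by (simp add: v_def)
qed (use assms in simp)

lemma smoothstep_iterate_near_one:
  assumes "cmod (1 - u) \<le> 1 / 10"
  shows "cmod (1 - (smoothstep ^^ m) u) \<le> (1 / 2) ^ m / 10"
proof -
  have "1 - (smoothstep ^^ m) u = (smoothstep ^^ m) (1 - u)"
    by (induction m) (simp_all add: smoothstep_flip)
  then show ?thesis using smoothstep_iterate_small[OF assms] by simp
qed

lemma poly_fun_smoothstep_iterate: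
  assumes "p \<in> poly_fun"
  shows "(\<lambda>z. (smoothstep ^^ m) (p z)) \<in> poly_fun"
proof (induction m)
  case (Suc m)
  let ?q = "\<lambda>z. (smoothstep ^^ m) (p z)"
  have "(\<lambda>z. ?q z ^ 2 * (3 - 2 * ?q z)) \<in> poly_fun"
    by (rule poly_fun.mult[OF poly_fun_power[OF Suc]
          poly_fun_diff[OF poly_fun.const poly_fun.mult[OF poly_fun.const Suc]]])
  then show ?case by (simp add: smoothstep_def[of "(smoothstep ^^ m) _"])
qed (simp add: assms)

text \<open>Two stages: the approximate exponential of 12 (h - 1) sends the two sets into discs of
  radius 1 / 10 around 1 and 0, and iterating \<open>smoothstep\<close> contracts both discs to
  their centres at the same time.\<close>

lemma separating_polynomial:
  assumes S: "compact S" and h: "h \<in> poly_fun" and d: "d > 0"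
  obtains u where "u \<in> poly_fun"
    "\<And>x. cmod (h x - 1) \<le> 1 / 300 \<Longrightarrow> cmod (1 - u x) \<le> d"
    "\<And>x. x \<in> S \<Longrightarrow> Re (h x) \<le> 1 / 2 \<Longrightarrow> cmod (u x) \<le> d"
proof -
  obtain M where M: "M > 0" "\<And>x. x \<in> S \<Longrightarrow> cmod (h x) \<le> M" using poly_fun_bounded[OF h S] by metis
  obtain n where n: "n > 0" "72 * (M + 1)\<^sup>2 \<le> real n"
  proof -
    obtain n where "72 * (M + 1)\<^sup>2 \<le> real n" using real_arch_simple by blast
    then show ?thesis using that[of "Suc n"] by simp
  qed
  have "(\<lambda>m. (1 / 2 :: real) ^ m / 10) \<longlonglongrightarrow> 0 / 10" by (intro tendsto_intros LIMSEQ_realpow_zero) auto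
  then have "\<forall>\<^sub>F m in sequentially. (1 / 2 :: real) ^ m / 10 < d" by (rule order_tendstoD) (simp add: d)
  then obtain m where m: "(1 / 2 :: real) ^ m / 10 < d" by (auto simp: eventually_sequentially)
  define v where "v = (\<lambda>x. (1 + of_real (12 / real n) * (h x - 1)) ^ n)"
  have v: "v \<in> poly_fun" unfolding v_def
    by (rule poly_fun_power[OF poly_fun.add[OF poly_fun.const
          poly_fun.mult[OF poly_fun.const poly_fun_diff[OF h poly_fun.const]]]])
  show ?thesis
  proof (rule that[OF poly_fun_smoothstep_iterate[OF v, of m]])
    fix x assume "cmod (h x - 1) \<le> 1 / 300"
    then have "cmod (1 - v x) \<le> 1 / 10" unfolding v_def by (rule exp_like_near_one[OF n(1)])
    then show "cmod (1 - (smoothstep ^^ m) (v x)) \<le> d"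
      using smoothstep_iterate_near_one[of "v x" m] m by simp
  next
    fix x assume "x \<in> S" "Re (h x) \<le> 1 / 2"
    then have "cmod (v x) \<le> 1 / 10" unfolding v_def using M(2) by (intro exp_like_small[OF n])
    then show "cmod ((smoothstep ^^ m) (v x)) \<le> d"
      using smoothstep_iterate_small[of "v x" m] m by simp
  qed
qed

text \<open>The key step: a multiple of \<open>p\<close> that is still close to 1 on \<open>K\<close>, and whose superlevel set
  \<open>Re \<ge> 1 / 2\<close> lies in the previous one, so that countably many conditions collapse to a
  nested sequence of single ones.\<close>

lemma nested_multiple:
  assumes K: "compact K" "poly_hull K = K" and S: "compact S"
    and p: "p \<in> poly_fun" "\<And>z. z \<in> K \<Longrightarrow> p z \<noteq> 0"
    and h: "h \<in> poly_fun" "\<And>z. z \<in> K \<Longrightarrow> cmod (h z - 1) \<le> 1 / 300"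
  obtains q where "q \<in> poly_fun" "\<And>z. z \<in> K \<Longrightarrow> cmod (p z * q z - 1) \<le> 1 / 300"
    "\<And>x. x \<in> S \<Longrightarrow> 1 / 2 \<le> Re (p x * q x) \<Longrightarrow> 1 / 2 \<le> Re (h x)"
proof -
  obtain q where q: "q \<in> poly_fun" "\<And>x. x \<in> K \<Longrightarrow> cmod (1 - p x * q x) < 1 / 1000"
    by (rule poly_fun_approx_inverse[OF K p, of "1 / 1000"]) auto
  obtain B where B: "B > 0" "\<And>x. x \<in> S \<Longrightarrow> cmod (p x * q x) \<le> B"
    using poly_fun_bounded[OF poly_fun.mult[OF p(1) q(1)] S] by metis
  \<comment> \<open>The bound 1 / 1000 keeps the product with u within 1 / 300 of 1 on K. The bound
    1 / (4 B) gives it modulus at most 1 / 4 wherever Re h < 1 / 2, so its real part cannot reach 1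
    / 2 there.\<close>
  define d where "d = min (1 / 1000) (1 / (4 * B))"
  have d: "d > 0" "d \<le> 1 / 1000" "B * d \<le> 1 / 4"
  proof -
    have "B * d \<le> B * (1 / (4 * B))" using B by (intro mult_left_mono) (auto simp: d_def)
    then show "B * d \<le> 1 / 4" using B by simp
  qed (use B in \<open>auto simp: d_def\<close>)
  obtain u where u: "u \<in> poly_fun"
    "\<And>x. cmod (h x - 1) \<le> 1 / 300 \<Longrightarrow> cmod (1 - u x) \<le> d"
    "\<And>x. x \<in> S \<Longrightarrow> Re (h x) \<le> 1 / 2 \<Longrightarrow> cmod (u x) \<le> d"
    using separating_polynomial[OF S h(1) d(1)] by blast
  show ?thesis
  proof (rule that[OF poly_fun.mult[OF q(1) u(1)]])
    fix z assume z: "z \<in> K"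
    have uz: "cmod (1 - u z) \<le> 1 / 1000" using u(2)[OF h(2)[OF z]] d by simp
    then have "cmod (u z) \<le> 1001 / 1000" using norm_triangle_ineq2[of "u z" 1] by (simp add: norm_minus_commute)
    with uz have "cmod (1 * 1 - p z * q z * u z) \<le> 1 * (1 / 1000) + 1 / 1000 * (1001 / 1000)"
      using q(2)[OF z] by (intro norm_mult_diff_le) auto
    then show "cmod (p z * (q z * u z) - 1) \<le> 1 / 300" by (simp add: norm_minus_commute mult.assoc)
  next
    fix x assume x: "x \<in> S" and le: "1 / 2 \<le> Re (p x * (q x * u x))"
    show "1 / 2 \<le> Re (h x)"
    proof (rule ccontr)
      assume "\<not> 1 / 2 \<le> Re (h x)"
      then have "cmod (u x) \<le> d" using u(3)[OF x] by simp
      then have "cmod (p x * q x) * cmod (u x) \<le> B * d"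
        using B(2)[OF x] B(1) by (intro mult_mono) auto
      then have "cmod (p x * (q x * u x)) \<le> 1 / 4" using d by (simp add: norm_mult mult.assoc)
      then show False using le complex_Re_le_cmod[of "p x * (q x * u x)"] by linarith
    qed
  qed
qed

text \<open>For large \<open>R\<close> the modulus of \<open>h + R\<close> measures the real part of \<open>h\<close>.\<close>

lemma poly_hull_meets_superlevel_set:
  assumes S: "compact S" and z: "z \<in> poly_hull S" and h: "h \<in> poly_fun" and c: "c < Re (h z)" "0 \<le> c"
  shows "\<exists>x\<in>S. c \<le> Re (h x)"
proof (rule ccontr)
  assume "\<not> ?thesis"
  then have less: "Re (h x) \<le> c" if "x \<in> S" for x using that by force
  obtain M where M: "M > 0" "\<And>x. x \<in> S \<Longrightarrow> cmod (h x) \<le> M" using poly_fun_bounded[OF h S] by metis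
  \<comment> \<open>With this R the gain 2 R (Re h(z) - c) in the squared modulus at z equals twice
    \<open>M\<^sup>2\<close>, which exceeds the contribution of |h| on S.\<close>
  define R where "R = M\<^sup>2 / (Re (h z) - c)"
  have R: "R > 0" "R * (Re (h z) - c) = M\<^sup>2" using M c by (auto simp: R_def)
  have hR: "(\<lambda>x. h x + of_real R) \<in> poly_fun" by (rule poly_fun.add[OF h poly_fun.const])
  have "\<forall>p\<in>poly_fun. \<exists>x\<in>S. cmod (p z) \<le> cmod (p x)" using z by (simp add: poly_hull_def)
  from bspec[OF this hR] obtain x where x: "x \<in> S" "cmod (h z + of_real R) \<le> cmod (h x + of_real R)"
    by auto
  have "(Re (h z) + R)\<^sup>2 \<le> (cmod (h z + of_real R))\<^sup>2"
    unfolding cmod_power2 by simp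
  also have "\<dots> \<le> (cmod (h x + of_real R))\<^sup>2" using x(2) by (intro power_mono) auto
  also have "\<dots> = (cmod (h x))\<^sup>2 + 2 * R * Re (h x) + R\<^sup>2"
    unfolding cmod_power2 by (simp add: power2_eq_square algebra_simps)
  also have "\<dots> \<le> M\<^sup>2 + 2 * R * c + R\<^sup>2"
    using M(2)[OF x(1)] less[OF x(1)] R by (intro add_mono mult_left_mono power_mono) auto
  also have "\<dots> < (Re (h z))\<^sup>2 + 2 * (R * (Re (h z) - c)) + 2 * R * c + R\<^sup>2"
    unfolding R(2) using M c by (simp add: add_strict_increasing2)
  also have "\<dots> = (Re (h z) + R)\<^sup>2" by (simp add: power2_eq_square algebra_simps)
  finally show False by simp
qed

text \<open>A bounded part of a half plane Re >= c > 0, divided by a large R, lies in a disc around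
  1 of radius below 1. So \<open>PX_inverse\<close> inverts p q / R, and multiplying by q / R gives
  the inverse of p.\<close>

lemma invertible_PX_if_multiple_in_half_plane:
  assumes X: "compact X" and p: "p \<in> poly_fun" "q \<in> poly_fun"
    and c: "0 < c" "\<And>x. x \<in> X \<Longrightarrow> c \<le> Re (p x * q x)"
  shows "invertible_PX X p"
proof -
  define h where "h = (\<lambda>x. p x * q x)"
  have h: "h \<in> poly_fun" unfolding h_def by (rule poly_fun.mult[OF p])
  obtain M where M: "M > 0" "\<And>x. x \<in> X \<Longrightarrow> cmod (h x) \<le> M" using poly_fun_bounded[OF h X] by metis
  define R where "R = M\<^sup>2 / c"
  have R: "R > 0" "R * c = M\<^sup>2" using M c by (auto simp: R_def)
  \<comment> \<open>The choice R c = \<open>M\<^sup>2\<close> bounds the squared distance of h / R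
    from 1 by 1 - c / R. For empty X this number may be negative, hence the maximum with 0.\<close>
  define b where "b = sqrt (max 0 (1 - c / R))"
  have b: "b < 1" using c R by (simp add: b_def real_sqrt_lt_1_iff)
  let ?f = "\<lambda>x. of_real (1 / R) * h x"
  have f: "?f \<in> PX X" by (rule poly_fun_in_PX[OF poly_fun.mult[OF poly_fun.const h]])
  have "cmod (1 - ?f x) \<le> b" if x: "x \<in> X" for x
  proof -
    have "(cmod (1 - ?f x))\<^sup>2 = 1 - 2 * (1 / R) * Re (h x) + (1 / R)\<^sup>2 * (cmod (h x))\<^sup>2"
      unfolding cmod_power2 by (simp add: power2_eq_square algebra_simps diff_divide_distrib add_divide_distrib)
    also have "\<dots> \<le> 1 - 2 * (1 / R) * c + (1 / R)\<^sup>2 * M\<^sup>2"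
      using M(2)[OF x] c(2)[OF x] R unfolding h_def
      by (intro add_mono diff_mono mult_left_mono power_mono) auto
    also have "\<dots> = 1 - c / R" unfolding R(2)[symmetric] using R(1) by (simp add: field_simps power2_eq_square)
    finally have "(cmod (1 - ?f x))\<^sup>2 \<le> max 0 (1 - c / R)" by simp
    then show ?thesis unfolding b_def by (rule real_le_rsqrt)
  qed
  then have inv: "(\<lambda>x. inverse (?f x)) \<in> PX X" by (rule PX_inverse[OF f X b])
  have "(\<lambda>x. of_real (1 / R) * q x * inverse (?f x)) \<in> PX X"
    by (rule PX_mult[OF poly_fun_in_PX[OF poly_fun.mult[OF poly_fun.const p(2)]] inv X])
  moreover have "p x * (of_real (1 / R) * q x * inverse (?f x)) = 1" if x: "x \<in> X" for x
  proof -
    have "h x \<noteq> 0" using c(2)[OF x] c(1) by (auto simp: h_def)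
    then have "?f x * inverse (?f x) = 1" using R by (intro right_inverse) auto
    then show ?thesis by (simp only: h_def mult_ac)
  qed
  ultimately show ?thesis
    unfolding invertible_PX_def using poly_fun_in_PX[OF p(1)]
    by (intro conjI bexI[of _ "\<lambda>x. of_real (1 / R) * q x * inverse (?f x)"]) auto
qed

section \<open>A countable dense family of polynomials\<close>

fun rational_poly_funs :: "nat \<Rightarrow> (complex^'n \<Rightarrow> complex) set" where
  "rational_poly_funs 0 = (\<lambda>(a, b) z. Complex a b) ` (\<rat> \<times> \<rat>) \<union> range (\<lambda>i z. z $ i)"
| "rational_poly_funs (Suc n) = rational_poly_funs n \<union>
     (\<lambda>(p, q) z. p z + q z) ` (rational_poly_funs n \<times> rational_poly_funs n) \<union>
     (\<lambda>(p, q) z. p z * q z) ` (rational_poly_funs n \<times> rational_poly_funs n)"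

text \<open>The stages make an induction possible: each arises from countable sets by products,
  images and finite unions.\<close>

lemma countable_rational_poly_funs:
  "countable (\<Union>n. rational_poly_funs n :: (complex^'n \<Rightarrow> complex) set)"
proof -
  have "countable (rational_poly_funs n :: (complex^'n \<Rightarrow> complex) set)" for n
  proof (induction n)
    case 0
    have "countable (range (\<lambda>i (z :: complex^'n). z $ i))" by (intro countable_image countable_finite) simp
    then show ?case by (simp add: countable_rat)
  qed simp
  then show ?thesis by simp
qed

lemma rational_poly_funs_mono: "m \<le> n \<Longrightarrow> rational_poly_funs m \<subseteq> rational_poly_funs n"
  by (rule lift_Suc_mono_le[of rational_poly_funs]) auto

lemma rational_poly_funs_subset:
  "(\<Union>n. rational_poly_funs n) \<subseteq> (poly_fun :: (complex^'n \<Rightarrow> complex) set)"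
proof -
  have "rational_poly_funs n \<subseteq> (poly_fun :: (complex^'n \<Rightarrow> complex) set)" for n
  proof (induction n)
    case 0
    show ?case using poly_fun.const poly_fun.coord by auto
  next
    case (Suc n)
    then show ?case by (auto intro!: poly_fun.add poly_fun.mult)
  qed
  then show ?thesis by blast
qed

lemma rational_poly_funs_dense:
  assumes S: "compact S" and p: "p \<in> poly_fun" and e: "e > 0"
  shows "\<exists>q\<in>(\<Union>n. rational_poly_funs n). \<forall>x\<in>S. cmod (p x - q x) < e"
  using p e
proof (induction arbitrary: e)
  case (const c)
  have "\<exists>a\<in>\<rat>. \<bar>r - a\<bar> < e / 2" for r :: real
  proof -
    obtain a where "a \<in> \<rat>" "r - e / 2 < a" "a < r + e / 2"
      using Rats_dense_in_real[of "r - e / 2" "r + e / 2"] const by auto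
    moreover from this have "\<bar>r - a\<bar> < e / 2" by linarith
    ultimately show ?thesis by blast
  qed
  then obtain a b where a: "a \<in> \<rat>" "\<bar>Re c - a\<bar> < e / 2" and b: "b \<in> \<rat>" "\<bar>Im c - b\<bar> < e / 2"
    by blast
  have "cmod (c - Complex a b) < e" using cmod_le[of "c - Complex a b"] a b by simp
  moreover have "(\<lambda>z. Complex a b) \<in> rational_poly_funs 0"
    unfolding rational_poly_funs.simps using a b by (intro UnI1 image_eqI[of _ _ "(a, b)"]) auto
  ultimately show ?case by (intro bexI[of _ "\<lambda>z. Complex a b"] ballI UN_I[of 0] UNIV_I)
next
  case (coord i)
  have "(\<lambda>z. z $ i) \<in> rational_poly_funs 0" by auto
  then show ?case using coord by (intro bexI[of _ "\<lambda>z. z $ i"] ballI UN_I[of 0] UNIV_I) simp_all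
next
  case (add p q)
  have "e / 2 > 0" using add by simp
  then obtain p' q' m n where p': "p' \<in> rational_poly_funs m" "\<forall>x\<in>S. cmod (p x - p' x) < e / 2"
    and q': "q' \<in> rational_poly_funs n" "\<forall>x\<in>S. cmod (q x - q' x) < e / 2"
    using add.IH by blast
  have "p' \<in> rational_poly_funs (max m n)" "q' \<in> rational_poly_funs (max m n)"
    using p' q' rational_poly_funs_mono[of m "max m n"] rational_poly_funs_mono[of n "max m n"] by auto
  then have "(\<lambda>z. p' z + q' z) \<in> rational_poly_funs (Suc (max m n))"
    unfolding rational_poly_funs.simps by (intro UnI1 UnI2 image_eqI[of _ _ "(p', q')"]) auto
  moreover have "cmod (p x + q x - (p' x + q' x)) < e" if "x \<in> S" for x
    using norm_diff_triangle_ineq[of "p x" "q x" "p' x" "q' x"] p'(2) q'(2) that by fastforce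
  ultimately show ?case by (intro bexI[of _ "\<lambda>z. p' z + q' z"] ballI UN_I[of "Suc (max m n)"] UNIV_I)
next
  case (mult p q)
  obtain B where B: "B > 0" "\<And>x. x \<in> S \<Longrightarrow> cmod (p x) \<le> B" using poly_fun_bounded[OF mult.hyps(1) S] by metis
  obtain q' n where q': "q' \<in> rational_poly_funs n" "\<forall>x\<in>S. cmod (q x - q' x) < e / (4 * B)"
    using mult.IH(2)[of "e / (4 * B)"] mult.prems B by auto
  then have "q' \<in> poly_fun" using rational_poly_funs_subset by blast
  then obtain C where C: "C > 0" "\<And>x. x \<in> S \<Longrightarrow> cmod (q' x) \<le> C" using poly_fun_bounded[OF _ S] by metis
  obtain p' m where p': "p' \<in> rational_poly_funs m" "\<forall>x\<in>S. cmod (p x - p' x) < e / (4 * C)"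
    using mult.IH(1)[of "e / (4 * C)"] mult.prems C by auto
  have "p' \<in> rational_poly_funs (max m n)" "q' \<in> rational_poly_funs (max m n)"
    using p' q' rational_poly_funs_mono[of m "max m n"] rational_poly_funs_mono[of n "max m n"] by auto
  then have "(\<lambda>z. p' z * q' z) \<in> rational_poly_funs (Suc (max m n))"
    unfolding rational_poly_funs.simps by (intro UnI2 image_eqI[of _ _ "(p', q')"]) auto
  moreover have "cmod (p x * q x - p' x * q' x) < e" if x: "x \<in> S" for x
  proof -
    have "cmod (p x * q x - p' x * q' x) \<le> B * (e / (4 * B)) + e / (4 * C) * C"
      using B(2)[OF x] C(2)[OF x] p'(2) q'(2) x by (intro norm_mult_diff_le) (auto intro: less_imp_le)
    then show ?thesis using B(1) C(1) mult.prems by simp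
  qed
  ultimately show ?case by (intro bexI[of _ "\<lambda>z. p' z * q' z"] ballI UN_I[of "Suc (max m n)"] UNIV_I)
qed

text \<open>The rational polynomials themselves may fail P. Each is therefore replaced by
  polynomials satisfying P at distance below 1 / (m + 1) for every m, and these still form a
  countable dense family.\<close>

lemma dense_sequence:
  assumes S: "compact S"
    and dense: "\<forall>f\<in>PX S. \<forall>e>0. \<exists>p\<in>poly_fun. P p \<and> (\<forall>x\<in>S. cmod (f x - p x) < e)"
  obtains p :: "nat \<Rightarrow> complex^'n \<Rightarrow> complex" where "\<And>n. p n \<in> poly_fun" "\<And>n. P (p n)"
    "\<And>q e. q \<in> poly_fun \<Longrightarrow> e > 0 \<Longrightarrow> \<exists>n. \<forall>x\<in>S. cmod (q x - p n x) < e"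
proof -
  let ?Q = "\<Union>n. rational_poly_funs n :: (complex^'n \<Rightarrow> complex) set"
  have "\<exists>p\<in>poly_fun. P p \<and> (\<forall>x\<in>S. cmod (q x - p x) < 1 / real (Suc m))" if "q \<in> ?Q" for q m
    using dense poly_fun_in_PX[of q S] rational_poly_funs_subset that by fastforce
  then obtain F where F: "\<And>q m. q \<in> ?Q \<Longrightarrow> F q m \<in> poly_fun \<and> P (F q m) \<and>
      (\<forall>x\<in>S. cmod (q x - F q m x) < 1 / real (Suc m))"
    by metis
  define D where "D = (\<lambda>(q, m). F q m) ` (?Q \<times> UNIV)"
  have D: "countable D" unfolding D_def using countable_rational_poly_funs by (intro countable_image countable_SIGMA) auto
  have D_dense: "\<exists>p\<in>D. \<forall>x\<in>S. cmod (q x - p x) < e" if q: "q \<in> poly_fun" "e > 0" for q e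
  proof -
    have e2: "e / 2 > 0" using q by simp
    then obtain q' where q': "q' \<in> ?Q" "\<forall>x\<in>S. cmod (q x - q' x) < e / 2"
      using rational_poly_funs_dense[OF S q(1)] by blast
    obtain m where m: "1 / real (Suc m) < e / 2" using nat_approx_posE[OF e2] by blast
    have "cmod (q x - F q' m x) < e" if x: "x \<in> S" for x
    proof -
      have "cmod (q' x - F q' m x) < 1 / real (Suc m)" using F[OF q'(1), of m] x by blast
      then show ?thesis
        using norm_triangle_ineq[of "q x - q' x" "q' x - F q' m x"] q'(2) x m by fastforce
    qed
    moreover have "F q' m \<in> D" unfolding D_def using q'(1) by (intro image_eqI[of _ _ "(q', m)"]) auto
    ultimately show ?thesis by blast
  qed
  have "D \<noteq> {}" using D_dense[OF poly_fun.const[of 0], of 1] by auto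
  then have range: "range (from_nat_into D) = D" using D by (rule range_from_nat_into)
  show ?thesis
  proof (rule that[of "from_nat_into D"])
    have "f \<in> poly_fun \<and> P f" if "f \<in> D" for f using that F unfolding D_def by auto
    then show "from_nat_into D n \<in> poly_fun" "P (from_nat_into D n)" for n
      using range by (metis rangeI)+
    show "\<exists>n. \<forall>x\<in>S. cmod (q x - from_nat_into D n x) < e" if "q \<in> poly_fun" "e > 0" for q e
      using D_dense[OF that] range by (metis imageE)
  qed
qed

section \<open>The decreasing superlevel sets and their intersection\<close>

theorem theorem5p2:
  fixes Sigma K :: "(complex^'n) set" and k :: nat
  assumes "CARD('n) \<ge> 2"
    and "compact Sigma"
    and "2 \<le> k" and "k \<le> CARD('n)"
    and "compact K" and "K \<subseteq> poly_hull_k k Sigma" and "poly_hull K = K"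
    and "\<forall>f\<in>PX Sigma. \<forall>e>0. \<exists>p\<in>poly_fun. (\<forall>z\<in>K. p z \<noteq> 0) \<and>
            (\<forall>x\<in>Sigma. cmod (f x - p x) < e)"
  shows "\<exists>X. compact X \<and> X \<subseteq> Sigma \<and> K \<subseteq> rat_hull_k (k - 1) X \<and> dense_invertibles_PX X"
proof -
  note S = \<open>compact Sigma\<close>
  obtain p :: "nat \<Rightarrow> complex^'n \<Rightarrow> complex"
    where p: "\<And>n. p n \<in> poly_fun" and pK: "\<And>n. \<forall>z\<in>K. p n z \<noteq> 0"
    and p_dense: "\<And>q e. q \<in> poly_fun \<Longrightarrow> e > 0 \<Longrightarrow> \<exists>n. \<forall>x\<in>Sigma. cmod (q x - p n x) < e"
    by (rule dense_sequence[OF S assms(8)]) blast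
  \<comment> \<open>The tolerance 1 / 300 is the one under which
    \<open>separating_polynomial\<close> returns a factor close to 1; it also forces Re h > 1 / 2 on
    K.\<close>
  define good where "good = (\<lambda>h. h \<in> poly_fun \<and> (\<forall>z\<in>K. cmod (h z - 1) \<le> 1 / 300))"
  define step where "step = (\<lambda>n h h'. (\<exists>q\<in>poly_fun. h' = (\<lambda>x. p n x * q x)) \<and>
      (\<forall>x\<in>Sigma. 1 / 2 \<le> Re (h' x) \<longrightarrow> 1 / 2 \<le> Re (h x)))"
  have "good (\<lambda>x. 1)" by (simp add: good_def poly_fun.const)
  moreover have "\<exists>h'. good h' \<and> step n h h'" if "good h" for n h
  proof -
    obtain q where "q \<in> poly_fun" "\<And>z. z \<in> K \<Longrightarrow> cmod (p n z * q z - 1) \<le> 1 / 300"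
      "\<And>x. x \<in> Sigma \<Longrightarrow> 1 / 2 \<le> Re (p n x * q x) \<Longrightarrow> 1 / 2 \<le> Re (h x)"
      using nested_multiple[OF assms(5,7) S p[of n], of h] pK[of n] \<open>good h\<close> unfolding good_def by blast
    then show ?thesis
      unfolding good_def step_def using poly_fun.mult[OF p[of n]]
      by (intro exI[of _ "\<lambda>x. p n x * q x"]) auto
  qed
  \<comment> \<open>The index is shifted: \<open>h (Suc n)\<close> is a multiple of
    \<open>p n\<close>, while \<open>h 0\<close> is just some good starting function.\<close>
  ultimately obtain h where h: "\<And>n. good (h n)" "\<And>n. step n (h n) (h (Suc n))"
    using dependent_nat_choice[of "\<lambda>_. good" step] by metis
  have hpoly: "h n \<in> poly_fun" for n using h(1) by (auto simp: good_def)
  define Y where "Y = (\<lambda>n. {x \<in> Sigma. 1 / 2 \<le> Re (h n x)})"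
  have Y: "compact (Y n)" for n
  proof -
    have "closed {x. 1 / 2 \<le> Re (h n x)}"
      by (intro closed_Collect_le continuous_intros continuous_on_poly_fun hpoly)
    then show ?thesis unfolding Y_def using compact_Int_closed[OF S] by (simp add: Collect_conj_eq)
  qed
  have Y_Suc: "Y (Suc n) \<subseteq> Y n" for n using h(2)[of n] unfolding Y_def step_def by blast
  then have Y_mono: "Y n \<subseteq> Y m" if "m \<le> n" for m n using lift_Suc_antimono_le[of Y, OF _ that] by blast
  define X where "X = (\<Inter>n. Y n)"
  have X: "compact X" unfolding X_def using Y by (intro compact_Inter) auto
  have hull: "z \<in> rat_hull_k (k - 1) X" if z: "z \<in> K" for z
    unfolding rat_hull_k_def
  proof (intro CollectI allI impI)
    fix V :: "(complex^'n) set" and m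
    assume V: "1 \<le> m \<and> m \<le> k - 1 \<and> pure_codim_subvariety m V \<and> z \<in> V"
    then have "closed V"
      by (auto simp: pure_codim_subvariety_def pure_dim_subvariety_def analytic_subvariety_def)
    \<comment> \<open>The second clause of \<open>poly_hull_k\<close> applies, since V has
      codimension at most k - 1. It supplies a hull of the slice by V itself, which yields points of
      V in each \<open>Y n\<close>.\<close>
    have zV: "z \<in> poly_hull (Sigma \<inter> V)"
      using assms(6) z V unfolding poly_hull_k_def by blast
    have "\<Inter> (range (\<lambda>n. Y n \<inter> V)) \<noteq> {}"
    proof (rule compact_nest)
      show "compact (Y n \<inter> V)" for n using Y \<open>closed V\<close> by (rule compact_Int_closed)
      show "Y n \<inter> V \<subseteq> Y m \<inter> V" if "m \<le> n" for m n using Y_mono[OF that] by blast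
      fix n
      have "cmod (h n z - 1) \<le> 1 / 300" using h(1)[of n] z by (auto simp: good_def)
      \<comment> \<open>The inequality is strict at z, as
        \<open>poly_hull_meets_superlevel_set\<close> requires.\<close>
      then have "1 / 2 < Re (h n z)" using abs_Re_le_cmod[of "h n z - 1"] by simp
      then obtain x where "x \<in> Sigma \<inter> V" "1 / 2 \<le> Re (h n x)"
        using poly_hull_meets_superlevel_set[OF compact_Int_closed[OF S \<open>closed V\<close>] zV hpoly[of n], of "1 / 2"]
        by auto
      then show "Y n \<inter> V \<noteq> {}" by (auto simp: Y_def)
    qed
    then show "V \<inter> X \<noteq> {}" by (auto simp: X_def)
  qed
  have inv: "invertible_PX X (p n)" for n
  proof -
    obtain q where q: "q \<in> poly_fun" "h (Suc n) = (\<lambda>x. p n x * q x)"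
      using h(2)[of n] by (auto simp: step_def)
    have "1 / 2 \<le> Re (p n x * q x)" if "x \<in> X" for x
      using that q(2) unfolding X_def Y_def by (metis (mono_tags, lifting) INT_E UNIV_I mem_Collect_eq)
    then show ?thesis by (intro invertible_PX_if_multiple_in_half_plane[OF X p q(1), of "1 / 2"]) auto
  qed
  have XS: "X \<subseteq> Sigma" by (auto simp: X_def Y_def)
  have "dense_invertibles_PX X"
    unfolding dense_invertibles_PX_def
  proof (intro ballI allI impI)
    fix f :: "complex^'n \<Rightarrow> complex" and e :: real
    assume f: "f \<in> PX X" and e: "e > 0"
    have e2: "e / 2 > 0" using e by simp
    obtain q where q: "q \<in> poly_fun" "\<And>x. x \<in> X \<Longrightarrow> cmod (f x - q x) < e / 2"
      using PX_E[OF f e2] by blast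
    \<comment> \<open>An element of P(X) need not extend to P(Sigma), so it is first replaced by a
      polynomial q. The sequence approximates q on all of Sigma, in particular on X.\<close>
    obtain n where n: "\<forall>x\<in>Sigma. cmod (q x - p n x) < e / 2" using p_dense[OF q(1) e2] by blast
    have "cmod (f x - p n x) < e" if x: "x \<in> X" for x
    proof -
      have "cmod (q x - p n x) < e / 2" using n XS x by blast
      then show ?thesis using norm_triangle_ineq[of "f x - q x" "q x - p n x"] q(2)[OF x] by simp
    qed
    then show "\<exists>g. invertible_PX X g \<and> (\<forall>x\<in>X. cmod (f x - g x) < e)"
      using inv by blast
  qed
  then show ?thesis using X XS hull by blast
qed

end
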